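(* There exist an algorithm and an absolute constant $A>0$ such that, for every integer $n\ge 2$, every $\mathbf{d}\in\mathbb{R}^n$ and every real $\gamma>0$, the algorithm, given $(\mathbf{d},\gamma)$, uses at most $A\, n\log n$ flops and outputs exactly the (unique) solution of $$\operatorname*{arg\,min}_{\mathbf{c}\in\mathbb{R}^n}\ \tfrac12\|\mathbf{c}-\mathbf{d}\|_2^2+\gamma\|\mathbf{c}\|_1\quad\text{subject to}\quad \mathbf{c}^T\mathbf{1}=1 .$$ That is, the problem can be solved exactly in $\mathcal{O}(n\log n)$ flops.
   Context: $\mathbf{1}\in\mathbb{R}^n$ is the all-ones vector and $\|\mathbf{c}\|_1=\sum_{i=1}^n|c_i|$. The objective is strongly convex and the feasible set is a nonempty affine hyperplane, so the minimizer is unique. Computation is in the exact real-arithmetic model: a flop is one elementary operation on real numbers (addition, subtraction, multiplication, division, comparison, or copying/accessing a stored number). "Exactly" means that there is no optimization error: in exact arithmetic the output equals the minimizer (in floating point there may be roundoff error only). *)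

theory Defs
  imports Complex_Main "Jordan_Normal_Form.Matrix"
begin

subsection \<open>The optimization problem\<close>

definition l2_norm :: "real vec \<Rightarrow> real" where
  "l2_norm v = sqrt (\<Sum>i<dim_vec v. (v $ i)\<^sup>2)"

definition l1_norm :: "real vec \<Rightarrow> real" where
  "l1_norm v = (\<Sum>i<dim_vec v. \<bar>v $ i\<bar>)"

definition ones_vec :: "nat \<Rightarrow> real vec" where
  "ones_vec n = vec n (\<lambda>_. 1)"

definition objective :: "real vec \<Rightarrow> real \<Rightarrow> real vec \<Rightarrow> real" where
  "objective d \<gamma> c = 1 / 2 * (l2_norm (c - d))\<^sup>2 + \<gamma> * l1_norm c"

definition feasible :: "nat \<Rightarrow> real vec \<Rightarrow> bool" where
  "feasible n c \<longleftrightarrow> c \<in> carrier_vec n \<and> c \<bullet> ones_vec n = 1"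


subsection \<open>Exact real-arithmetic programs\<close>

text \<open>
  A real RAM: real registers, real arrays, and natural-number registers that serve only as
  counters and array subscripts. A program is a finite piece of syntax that does not depend on
  the input size. No instruction moves information from reals to naturals: real data can
  influence the control flow only through the tests \<open>RLess\<close> and \<open>RLe\<close>. The first argument of
  a register instruction is its target register.
\<close>

record state =
  ireg :: "nat \<Rightarrow> nat"
  rreg :: "nat \<Rightarrow> real"
  arr :: "nat \<Rightarrow> nat \<Rightarrow> real"

datatype instr =
    IConst nat nat
  | ICopy nat nat
  | IAdd nat nat nat
  | ISub nat nat nat
  | RConst nat int
  | RCopy nat nat
  | RAdd nat nat nat
  | RSub nat nat nat
  | RMul nat nat nat
  | RDiv nat nat nat
  | Load nat nat nat  \<comment> \<open>target real register, array, register holding the subscript\<close>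
  | Store nat nat nat  \<comment> \<open>array, register holding the subscript, source real register\<close>

datatype test =
    ILess nat nat
  | ILe nat nat
  | RLess nat nat
  | RLe nat nat

datatype com =
    Skip
  | Instr instr
  | Seq com com
  | Cond test com com
  | While test com

fun defined :: "instr \<Rightarrow> state \<Rightarrow> bool" where
  "defined (RDiv x y z) s \<longleftrightarrow> rreg s z \<noteq> 0"
| "defined _ s \<longleftrightarrow> True"

fun exec :: "instr \<Rightarrow> state \<Rightarrow> state" where
  "exec (IConst x k) s = s\<lparr>ireg := (ireg s)(x := k)\<rparr>"
| "exec (ICopy x y) s = s\<lparr>ireg := (ireg s)(x := ireg s y)\<rparr>"
| "exec (IAdd x y z) s = s\<lparr>ireg := (ireg s)(x := ireg s y + ireg s z)\<rparr>"
| "exec (ISub x y z) s = s\<lparr>ireg := (ireg s)(x := ireg s y - ireg s z)\<rparr>"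
| "exec (RConst x k) s = s\<lparr>rreg := (rreg s)(x := of_int k)\<rparr>"
| "exec (RCopy x y) s = s\<lparr>rreg := (rreg s)(x := rreg s y)\<rparr>"
| "exec (RAdd x y z) s = s\<lparr>rreg := (rreg s)(x := rreg s y + rreg s z)\<rparr>"
| "exec (RSub x y z) s = s\<lparr>rreg := (rreg s)(x := rreg s y - rreg s z)\<rparr>"
| "exec (RMul x y z) s = s\<lparr>rreg := (rreg s)(x := rreg s y * rreg s z)\<rparr>"
| "exec (RDiv x y z) s = s\<lparr>rreg := (rreg s)(x := rreg s y / rreg s z)\<rparr>"
| "exec (Load x a i) s = s\<lparr>rreg := (rreg s)(x := arr s a (ireg s i))\<rparr>"
| "exec (Store a i x) s = s\<lparr>arr := (arr s)(a := (arr s a)(ireg s i := rreg s x))\<rparr>"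

fun holds :: "test \<Rightarrow> state \<Rightarrow> bool" where
  "holds (ILess x y) s \<longleftrightarrow> ireg s x < ireg s y"
| "holds (ILe x y) s \<longleftrightarrow> ireg s x \<le> ireg s y"
| "holds (RLess x y) s \<longleftrightarrow> rreg s x < rreg s y"
| "holds (RLe x y) s \<longleftrightarrow> rreg s x \<le> rreg s y"

text \<open>
  \<open>big_step c s t s'\<close>: started in \<open>s\<close>, program \<open>c\<close> terminates in \<open>s'\<close> after exactly \<open>t\<close>
  elementary operations. Every executed instruction and every evaluated test costs one unit,
  also those on counters and subscripts, so \<open>t\<close> bounds the number of operations on reals
  from above. A division by zero has no execution.
\<close>

inductive big_step :: "com \<Rightarrow> state \<Rightarrow> nat \<Rightarrow> state \<Rightarrow> bool" where
  Skip: "big_step Skip s 0 s"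
| Instr: "defined i s \<Longrightarrow> big_step (Instr i) s 1 (exec i s)"
| Seq: "big_step c1 s t1 s' \<Longrightarrow> big_step c2 s' t2 s'' \<Longrightarrow> big_step (Seq c1 c2) s (t1 + t2) s''"
| CondTrue: "holds b s \<Longrightarrow> big_step c1 s t s' \<Longrightarrow> big_step (Cond b c1 c2) s (1 + t) s'"
| CondFalse: "\<not> holds b s \<Longrightarrow> big_step c2 s t s' \<Longrightarrow> big_step (Cond b c1 c2) s (1 + t) s'"
| WhileFalse: "\<not> holds b s \<Longrightarrow> big_step (While b c) s 1 s"
| WhileTrue: "holds b s \<Longrightarrow> big_step c s t1 s' \<Longrightarrow> big_step (While b c) s' t2 s'' \<Longrightarrow>
    big_step (While b c) s (1 + t1 + t2) s''"

inductive_cases SkipE: "big_step Skip s t s'"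
inductive_cases InstrE: "big_step (Instr i) s t s'"
inductive_cases SeqE: "big_step (Seq c1 c2) s t s'"
inductive_cases CondE: "big_step (Cond b c1 c2) s t s'"
inductive_cases WhileE: "big_step (While b c) s t s'"

lemma big_step_deterministic:
  "big_step c s t s' \<Longrightarrow> big_step c s u r \<Longrightarrow> u = t \<and> r = s'"
proof (induction arbitrary: u r rule: big_step.induct)
  case (Skip s)
  then show ?case by (rule SkipE) simp
next
  case (Instr i s)
  from Instr.prems show ?case by (rule InstrE) simp
next
  case (Seq c1 s t1 s' c2 t2 s'')
  from Seq.prems obtain v1 q v2 where "big_step c1 s v1 q" "big_step c2 q v2 r" "u = v1 + v2"
    by (rule SeqE)
  then show ?case using Seq.IH by blast
next
  case (CondTrue b s c1 t s' c2)
  from CondTrue.prems show ?case by (rule CondE) (use CondTrue.IH CondTrue.hyps(1) in auto)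
next
  case (CondFalse b s c2 t s' c1)
  from CondFalse.prems show ?case by (rule CondE) (use CondFalse.IH CondFalse.hyps(1) in auto)
next
  case (WhileFalse b s c)
  from WhileFalse.prems show ?case by (rule WhileE) (use WhileFalse.hyps in auto)
next
  case (WhileTrue b s c t1 s' t2 s'')
  from WhileTrue.prems WhileTrue.hyps(1) obtain v1 q v2
    where "big_step c s v1 q" "big_step (While b c) q v2 r" "u = 1 + v1 + v2"
    by (cases rule: big_step.cases) auto
  then show ?case using WhileTrue.IH by blast
qed

text \<open>
  The input \<open>(d, \<gamma>)\<close> is stored with the dimension in counter 0, \<open>\<gamma>\<close> in real register 0 and
  \<open>d\<close> in array 0; everything else is zero. The output is read off array 1.
\<close>

definition input_state :: "real vec \<Rightarrow> real \<Rightarrow> state" where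
  "input_state d \<gamma> =
    \<lparr>ireg = (\<lambda>_. 0)(0 := dim_vec d),
     rreg = (\<lambda>_. 0)(0 := \<gamma>),
     arr = (\<lambda>_ _. 0)(0 := (\<lambda>i. if i < dim_vec d then d $ i else 0))\<rparr>"

definition output_vec :: "nat \<Rightarrow> state \<Rightarrow> real vec" where
  "output_vec n s = vec n (arr s 1)"

end

theory Submission imports Defs begin

text \<open>
  By the optimality conditions the minimizer is \<open>c i = soft \<gamma> (d i - \<mu>)\<close>, where \<open>soft\<close> is
  soft thresholding and the multiplier \<open>\<mu>\<close> is a root of
  \<open>g \<mu> = (\<Sum>i<n. soft \<gamma> (d i - \<mu>)) = 1\<close>. The function \<open>g\<close> is piecewise affine with breakpoints
  \<open>d i - \<gamma>\<close> and \<open>d i + \<gamma>\<close>. Merge sort orders the breakpoints in \<open>O(n log n)\<close> operations. A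
  binary search, whose \<open>O(log n)\<close> rounds each evaluate \<open>g\<close> in \<open>O(n)\<close>, then finds two
  consecutive breakpoints at which \<open>g \<ge> 1\<close> and \<open>g \<le> 1\<close>; linear interpolation between them
  yields \<open>\<mu>\<close> exactly.

  To keep all lengths powers of two, the array of the \<open>2 * n\<close> breakpoints is padded to length
  \<open>M = 2 ^ K\<close> with zeros: spurious breakpoints do no harm. Level \<open>l\<close> of the merge sort occupies
  the positions from \<open>l * M\<close> on of one array, so no copying back is needed. A value below all
  breakpoints, where \<open>g \<ge> n\<close>, is put in front of the sorted array to start the binary search.
\<close>

section \<open>Total correctness with time bounds\<close>

text \<open>Total correctness with a time budget: existence of an execution includes termination and
  absence of division by zero. \<open>T\<close> is only an upper bound, so budgets can be rounded
  up.\<close>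

definition runs :: "com \<Rightarrow> state \<Rightarrow> nat \<Rightarrow> (state \<Rightarrow> bool) \<Rightarrow> bool" where
  "runs c s T Q \<longleftrightarrow> (\<exists>t s'. big_step c s t s' \<and> t \<le> T \<and> Q s')"

notation Seq (infixr ";;" 60)

lemma runs_mono: "runs c s T Q \<Longrightarrow> T \<le> T' \<Longrightarrow> (\<And>s'. Q s' \<Longrightarrow> Q' s') \<Longrightarrow> runs c s T' Q'"
  unfolding runs_def by (meson order_trans)

section \<open>Symbolic execution of straight-line code\<close>

lemma big_step_Skip: "big_step Skip s t s' \<longleftrightarrow> t = 0 \<and> s' = s"
  by (auto elim: SkipE intro: big_step.Skip)

lemma big_step_Instr: "big_step (Instr i) s t s' \<longleftrightarrow> defined i s \<and> t = 1 \<and> s' = exec i s"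
  using big_step.Instr[of i s] by (auto elim: InstrE)

lemma big_step_Cond: "big_step (Cond b c1 c2) s t s' \<longleftrightarrow>
    (\<exists>u. t = Suc u \<and> big_step (if holds b s then c1 else c2) s u s')"
  using big_step.CondTrue[of b s c1 _ s' c2] big_step.CondFalse[of b s c2 _ s' c1]
  by (auto elim!: CondE)

lemma runs_Skip: "runs Skip s T Q \<longleftrightarrow> Q s"
  by (auto simp: runs_def big_step_Skip)

lemma runs_Instr: "runs (Instr i) s T Q \<longleftrightarrow> defined i s \<and> 1 \<le> T \<and> Q (exec i s)"
  by (auto simp: runs_def big_step_Instr)

text \<open>The exact cost \<open>t\<close> of \<open>c1\<close> is kept and the rest of the budget
  is passed on; \<open>t \<le> T\<close> makes the truncated subtraction faithful.\<close>

lemma runs_Seq_iff: "runs (c1 ;; c2) s T Q \<longleftrightarrow>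
    (\<exists>t s'. big_step c1 s t s' \<and> t \<le> T \<and> runs c2 s' (T - t) Q)"
proof
  assume "runs (c1 ;; c2) s T Q"
  then obtain t s' where "big_step (c1 ;; c2) s t s'" "t \<le> T" "Q s'"
    unfolding runs_def by blast
  then obtain t1 r t2 where "big_step c1 s t1 r" "big_step c2 r t2 s'" "t1 + t2 \<le> T" "Q s'"
    by (auto elim: SeqE)
  moreover from this have "t1 \<le> T" "t2 \<le> T - t1" by auto
  ultimately show "\<exists>t s'. big_step c1 s t s' \<and> t \<le> T \<and> runs c2 s' (T - t) Q"
    unfolding runs_def by blast
next
  assume "\<exists>t s'. big_step c1 s t s' \<and> t \<le> T \<and> runs c2 s' (T - t) Q"
  then obtain t r u s' where "big_step c1 s t r" "t \<le> T" "big_step c2 r u s'" "u \<le> T - t" "Q s'"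
    unfolding runs_def by blast
  moreover from this have "big_step (c1 ;; c2) s (t + u) s'" "t + u \<le> T"
    by (auto intro: big_step.Seq)
  ultimately show "runs (c1 ;; c2) s T Q" unfolding runs_def by blast
qed

lemma runs_Seq_Skip: "runs (Skip ;; c) s T Q \<longleftrightarrow> runs c s T Q"
  by (auto simp: runs_Seq_iff big_step_Skip)

lemma runs_Seq_Instr: "runs (Instr i ;; c) s T Q \<longleftrightarrow>
    defined i s \<and> 1 \<le> T \<and> runs c (exec i s) (T - 1) Q"
  by (auto simp: runs_Seq_iff big_step_Instr)

lemma runs_Seq_Seq: "runs ((c1 ;; c2) ;; c3) s T Q \<longleftrightarrow> runs (c1 ;; c2 ;; c3) s T Q"
proof
  assume "runs ((c1 ;; c2) ;; c3) s T Q"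
  then obtain t u r r' where h: "big_step c1 s t r" "big_step c2 r u r'" "t + u \<le> T"
      "runs c3 r' (T - (t + u)) Q"
    by (auto simp: runs_Seq_iff[of "c1 ;; c2"] elim!: SeqE)
  have "t \<le> T" "u \<le> T - t" "T - t - u = T - (t + u)" using h(3) by auto
  with h show "runs (c1 ;; c2 ;; c3) s T Q" unfolding runs_Seq_iff by metis
next
  assume "runs (c1 ;; c2 ;; c3) s T Q"
  then obtain t u r r' where h: "big_step c1 s t r" "big_step c2 r u r'" "t \<le> T" "u \<le> T - t"
      "runs c3 r' (T - t - u) Q"
    unfolding runs_Seq_iff by blast
  have "big_step (c1 ;; c2) s (t + u) r'" "t + u \<le> T" "T - t - u = T - (t + u)"
    using h by (auto intro: big_step.Seq)
  with h(5) show "runs ((c1 ;; c2) ;; c3) s T Q" unfolding runs_Seq_iff[of "c1 ;; c2"] by metis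
qed

lemma ex_Suc_le: "(\<exists>t s'. (\<exists>u. t = Suc u \<and> P u s') \<and> t \<le> T \<and> R t s') \<longleftrightarrow>
    1 \<le> T \<and> (\<exists>u s'. P u s' \<and> u \<le> T - 1 \<and> R (Suc u) s')"
  by (cases T) auto

lemma runs_Cond: "runs (Cond b c1 c2) s T Q \<longleftrightarrow>
    1 \<le> T \<and> (if holds b s then runs c1 s (T - 1) Q else runs c2 s (T - 1) Q)"
  unfolding runs_def big_step_Cond ex_Suc_le by simp

text \<open>Moving the continuation into both branches lets rewriting follow every path of loop-free
  code and count its cost.\<close>

lemma runs_Seq_Cond: "runs (Cond b c1 c2 ;; c) s T Q \<longleftrightarrow>
    1 \<le> T \<and> (if holds b s then runs (c1 ;; c) s (T - 1) Q else runs (c2 ;; c) s (T - 1) Q)"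
  unfolding runs_Seq_iff big_step_Cond ex_Suc_le by simp

primrec block :: "instr list \<Rightarrow> com" where
  "block [] = Skip"
| "block (i # is) = Instr i ;; block is"

lemmas runs_simps = runs_Skip runs_Instr runs_Seq_Skip runs_Seq_Instr runs_Seq_Seq
  runs_Cond runs_Seq_Cond

lemma runs_Seq:
  assumes "runs c1 s T1 R" "\<And>s'. R s' \<Longrightarrow> runs c2 s' T2 Q" "T1 + T2 \<le> T"
  shows "runs (c1 ;; c2) s T Q"
proof -
  obtain t s' where t: "big_step c1 s t s'" "t \<le> T1" "R s'"
    using assms(1) unfolding runs_def by blast
  have "runs c2 s' (T - t) Q"
    by (rule runs_mono[OF assms(2)[OF t(3)]]) (use t(2) assms(3) in auto)
  with t assms(3) show ?thesis unfolding runs_Seq_iff by (meson add_leD1 order_trans)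
qed

text \<open>Every loop of the program has a number \<open>N\<close> of rounds known in advance, so
  an invariant indexed by the finished rounds replaces a variant. Each round pays for its test and
  its body; the last unit is the failing test.\<close>

lemma runs_While:
  assumes "I 0 s"
    and "\<And>i s. i < N \<Longrightarrow> I i s \<Longrightarrow> holds b s"
    and "\<And>i s. i < N \<Longrightarrow> I i s \<Longrightarrow> runs c s T (I (Suc i))"
    and "\<And>s. I N s \<Longrightarrow> \<not> holds b s"
  shows "runs (While b c) s (N * Suc T + 1) (I N)"
proof -
  \<comment> \<open>Generalized to a start after \<open>i\<close> rounds with \<open>k\<close>
    rounds left, for induction on \<open>k\<close>.\<close>
  have "runs (While b c) s (k * Suc T + 1) (I N)" if "I i s" "i + k = N" for i k s
    using that
  proof (induction k arbitrary: i s)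
    case 0
    then have "\<not> holds b s" "I N s" using assms(4) by auto
    then have "big_step (While b c) s 1 s" "I N s" using big_step.WhileFalse by blast+
    then show ?case unfolding runs_def by auto
  next
    case (Suc k)
    then have "i < N" by simp
    with Suc.prems obtain t s' where t: "big_step c s t s'" "t \<le> T" "I (Suc i) s'"
      using assms(3) unfolding runs_def by blast
    obtain u r where u: "big_step (While b c) s' u r" "u \<le> k * Suc T + 1" "I N r"
      using Suc.IH[OF t(3)] Suc.prems(2) unfolding runs_def by auto
    have "big_step (While b c) s (1 + t + u) r"
      using big_step.WhileTrue assms(2) \<open>i < N\<close> Suc.prems t u by blast
    with t u show ?case unfolding runs_def by (intro exI[of _ "1 + t + u"] exI[of _ r]) auto
  qed
  from this[of 0 s N] assms(1) show ?thesis by simp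
qed

text \<open>The intermediate state stays a \<open>fold\<close> term instead of being expanded. The
  condition on \<open>is\<close> excludes division, the only partial instruction.\<close>

lemma runs_block_Seq:
  assumes "runs c (fold exec is s) T' Q" "list_all (\<lambda>i. \<forall>s. defined i s) is"
    "length is + T' \<le> T"
  shows "runs (block is ;; c) s T Q"
  using assms
proof (induction "is" arbitrary: s T)
  case Nil
  then show ?case by (auto simp: runs_Seq_Skip intro: runs_mono)
next
  case (Cons i "is")
  then have "runs (block is ;; c) (exec i s) (T - 1) Q" by (intro Cons.IH) auto
  with Cons.prems show ?case by (simp add: runs_simps)
qed

text \<open>A footprint: it lets a caller use the specification of a subprogram while keeping its
  own data in other registers and arrays.\<close>

definition frame :: "nat set \<Rightarrow> nat set \<Rightarrow> nat set \<Rightarrow> state \<Rightarrow> state \<Rightarrow> bool" where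
  "frame X Y Z s s' \<longleftrightarrow> (\<forall>x. x \<notin> X \<longrightarrow> ireg s' x = ireg s x) \<and>
     (\<forall>x. x \<notin> Y \<longrightarrow> rreg s' x = rreg s x) \<and> (\<forall>x. x \<notin> Z \<longrightarrow> arr s' x = arr s x)"

lemma frame_ireg: "frame X Y Z s s' \<Longrightarrow> x \<notin> X \<Longrightarrow> ireg s' x = ireg s x"
  and frame_rreg: "frame X Y Z s s' \<Longrightarrow> x \<notin> Y \<Longrightarrow> rreg s' x = rreg s x"
  and frame_arr: "frame X Y Z s s' \<Longrightarrow> x \<notin> Z \<Longrightarrow> arr s' x = arr s x"
  by (simp_all add: frame_def)

lemmas frame_same = frame_ireg frame_rreg frame_arr

lemma frame_trans:
  assumes "frame X Y Z s s'" "frame X' Y' Z' s' s''"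
    and "X \<union> X' \<subseteq> X''" "Y \<union> Y' \<subseteq> Y''" "Z \<union> Z' \<subseteq> Z''"
  shows "frame X'' Y'' Z'' s s''"
  using assms unfolding frame_def by (metis UnCI subsetD)

section \<open>The dual function\<close>

text \<open>The tests are nested in the order in which \<open>evaluate_body\<close> performs them.
  For \<open>\<gamma> > 0\<close> this is the usual soft thresholding.\<close>

definition soft :: "real \<Rightarrow> real \<Rightarrow> real" where
  "soft \<gamma> x = (if x - \<gamma> < 0 then if 0 < x + \<gamma> then 0 else x + \<gamma> else x - \<gamma>)"

definition shrink_sum :: "(nat \<Rightarrow> real) \<Rightarrow> nat \<Rightarrow> real \<Rightarrow> real \<Rightarrow> real" where
  "shrink_sum D n \<gamma> v = (\<Sum>i<n. soft \<gamma> (D i - v))"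

text \<open>\<open>soft \<gamma>\<close> is the proximal map of
  \<open>\<gamma> * \<bar>x\<bar>\<close>: the residual \<open>u - soft \<gamma> u\<close> equals
  \<open>\<gamma>\<close>, \<open>- \<gamma>\<close> or \<open>u\<close> in the three cases and is a
  subgradient at \<open>soft \<gamma> u\<close>.\<close>

lemma soft_subgradient:
  assumes "\<gamma> > 0"
  shows "\<gamma> * \<bar>x\<bar> \<ge> \<gamma> * \<bar>soft \<gamma> u\<bar> + (u - soft \<gamma> u) * (x - soft \<gamma> u)"
proof -
  consider "u \<ge> \<gamma>" | "u \<le> - \<gamma>" | "\<bar>u\<bar> < \<gamma>" by linarith
  then show ?thesis
  proof cases
    case 1
    then have [simp]: "soft \<gamma> u = u - \<gamma>" by (simp add: soft_def)
    have "\<gamma> * x \<le> \<gamma> * \<bar>x\<bar>" using assms by simp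
    then show ?thesis using 1 assms by (simp add: algebra_simps)
  next
    case 2
    then have [simp]: "soft \<gamma> u = u + \<gamma>" using assms by (simp add: soft_def)
    have "\<gamma> * (- x) \<le> \<gamma> * \<bar>x\<bar>" using assms by (intro mult_left_mono) auto
    then show ?thesis using 2 assms by (simp add: algebra_simps)
  next
    case 3
    then have [simp]: "soft \<gamma> u = 0" using assms by (auto simp: soft_def)
    have "u * x \<le> \<bar>u\<bar> * \<bar>x\<bar>" by (metis abs_ge_self abs_mult)
    also have "\<dots> \<le> \<gamma> * \<bar>x\<bar>" using 3 by (intro mult_right_mono) auto
    finally show ?thesis by simp
  qed
qed

text \<open>Neither kink lies strictly between \<open>a\<close> and \<open>b\<close>, so all the
  points involved are on one of the three affine pieces, one case each.\<close>

lemma soft_affine: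
  assumes "\<gamma> > 0" "0 \<le> \<theta>" "\<theta> \<le> 1"
    and "d - \<gamma> \<le> a \<or> b \<le> d - \<gamma>" "d + \<gamma> \<le> a \<or> b \<le> d + \<gamma>" "a \<le> b"
  shows "soft \<gamma> (d - (a + \<theta> * (b - a))) =
    soft \<gamma> (d - a) + \<theta> * (soft \<gamma> (d - b) - soft \<gamma> (d - a))"
proof -
  define v where "v = a + \<theta> * (b - a)"
  have "\<theta> * (b - a) \<le> 1 * (b - a)" using assms by (intro mult_right_mono) auto
  then have v: "a \<le> v" "v \<le> b" using assms by (auto simp: v_def)
  consider "b \<le> d - \<gamma>" | "d + \<gamma> \<le> a" | "d - \<gamma> \<le> a" "b \<le> d + \<gamma>" using assms by linarith
  then show ?thesis unfolding v_def[symmetric]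
  proof cases
    case 1
    then have e: "soft \<gamma> (d - v) = d - v - \<gamma>" "soft \<gamma> (d - a) = d - a - \<gamma>"
      "soft \<gamma> (d - b) = d - b - \<gamma>" using v by (auto simp: soft_def)
    then show "soft \<gamma> (d - v) = soft \<gamma> (d - a) + \<theta> * (soft \<gamma> (d - b) - soft \<gamma> (d - a))"
      by (simp only: e) (simp add: v_def algebra_simps)
  next
    case 2
    then have e: "soft \<gamma> (d - v) = d - v + \<gamma>" "soft \<gamma> (d - a) = d - a + \<gamma>"
      "soft \<gamma> (d - b) = d - b + \<gamma>" using v assms(1) by (auto simp: soft_def)
    then show "soft \<gamma> (d - v) = soft \<gamma> (d - a) + \<theta> * (soft \<gamma> (d - b) - soft \<gamma> (d - a))"
      by (simp only: e) (simp add: v_def algebra_simps)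
  next
    case 3
    then have e: "soft \<gamma> (d - v) = 0" "soft \<gamma> (d - a) = 0" "soft \<gamma> (d - b) = 0"
      using v assms(1) by (auto simp: soft_def)
    then show "soft \<gamma> (d - v) = soft \<gamma> (d - a) + \<theta> * (soft \<gamma> (d - b) - soft \<gamma> (d - a))"
      by simp
  qed
qed

text \<open>Every summand is affine between \<open>a\<close> and \<open>b\<close>, hence so is the
  sum; \<theta> is the weight at which the chord takes the value 1.\<close>

lemma shrink_sum_interpolate:
  assumes "\<gamma> > 0" "a \<le> b" "shrink_sum D n \<gamma> a \<ge> 1" "shrink_sum D n \<gamma> b \<le> 1"
    and "\<And>i. i < n \<Longrightarrow> D i - \<gamma> \<le> a \<or> b \<le> D i - \<gamma>"
    and "\<And>i. i < n \<Longrightarrow> D i + \<gamma> \<le> a \<or> b \<le> D i + \<gamma>"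
    and "shrink_sum D n \<gamma> a > shrink_sum D n \<gamma> b"
  shows "shrink_sum D n \<gamma>
    (a + (shrink_sum D n \<gamma> a - 1) / (shrink_sum D n \<gamma> a - shrink_sum D n \<gamma> b) * (b - a)) = 1"
proof -
  define \<theta> where "\<theta> = (shrink_sum D n \<gamma> a - 1) / (shrink_sum D n \<gamma> a - shrink_sum D n \<gamma> b)"
  have \<theta>: "0 \<le> \<theta>" "\<theta> \<le> 1" using assms by (auto simp: \<theta>_def divide_simps)
  have "shrink_sum D n \<gamma> (a + \<theta> * (b - a)) =
      shrink_sum D n \<gamma> a + \<theta> * (shrink_sum D n \<gamma> b - shrink_sum D n \<gamma> a)"
    unfolding shrink_sum_def sum_subtractf[symmetric] sum_distrib_left sum.distrib[symmetric]
    using soft_affine[OF assms(1) \<theta>] assms by (intro sum.cong) auto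
  also have "\<dots> = 1" using assms(7) by (simp add: \<theta>_def field_simps)
  finally show ?thesis by (simp add: \<theta>_def)
qed

text \<open>Strong convexity at a stationary point of the Lagrangian with multiplier \<mu>. The
  quadratic term yields uniqueness as well as minimality.\<close>

lemma objective_gap:
  assumes "\<gamma> > 0" "feasible n c" "feasible n x" "d \<in> carrier_vec n"
    and c: "\<And>i. i < n \<Longrightarrow> c $ i = soft \<gamma> (d $ i - \<mu>)"
  shows "objective d \<gamma> x \<ge> objective d \<gamma> c + (\<Sum>i<n. 1 / 2 * (x $ i - c $ i)\<^sup>2)"
proof -
  have obj: "objective d \<gamma> y = (\<Sum>i<n. 1 / 2 * (y $ i - d $ i)\<^sup>2 + \<gamma> * \<bar>y $ i\<bar>)"
    if "feasible n y" for y
  proof -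
    have "y \<in> carrier_vec n" using that by (simp add: feasible_def)
    then show ?thesis using assms(4)
      by (auto simp: objective_def l2_norm_def l1_norm_def sum_nonneg sum.distrib sum_distrib_left)
  qed
  have sum1: "(\<Sum>i<n. y $ i) = 1" if "feasible n y" for y
    using that by (auto simp: feasible_def scalar_prod_def ones_vec_def atLeast0LessThan)
  \<comment> \<open>The multiplier term vanishes since both points satisfy the constraint; adding it
    makes the inequality hold summand by summand.\<close>
  have "0 = (\<Sum>i<n. - \<mu> * (x $ i - c $ i))"
    using sum1 assms(2,3) by (simp add: sum_distrib_left[symmetric] sum_subtractf sum_negf)
  then have "objective d \<gamma> c + (\<Sum>i<n. 1 / 2 * (x $ i - c $ i)\<^sup>2) =
      (\<Sum>i<n. 1 / 2 * (c $ i - d $ i)\<^sup>2 + \<gamma> * \<bar>c $ i\<bar> + 1 / 2 * (x $ i - c $ i)\<^sup>2 - \<mu> * (x $ i - c $ i))"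
    by (simp add: obj[OF assms(2)] sum.distrib sum_subtractf sum_negf)
  also have "\<dots> \<le> objective d \<gamma> x"
    unfolding obj[OF assms(3)]
  proof (rule sum_mono)
    fix i assume "i \<in> {..<n}"
    then have "c $ i = soft \<gamma> (d $ i - \<mu>)" using c by simp
    with soft_subgradient[OF assms(1), of "d $ i - \<mu>" "x $ i"]
    have "\<gamma> * \<bar>x $ i\<bar> \<ge> \<gamma> * \<bar>c $ i\<bar> + (d $ i - \<mu> - c $ i) * (x $ i - c $ i)" by simp
    \<comment> \<open>Expanding the square of \<open>(x - c) + (c - d)\<close> reduces this to the
      subgradient inequality.\<close>
    then show "1 / 2 * (c $ i - d $ i)\<^sup>2 + \<gamma> * \<bar>c $ i\<bar> + 1 / 2 * (x $ i - c $ i)\<^sup>2 - \<mu> * (x $ i - c $ i)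
        \<le> 1 / 2 * (x $ i - d $ i)\<^sup>2 + \<gamma> * \<bar>x $ i\<bar>"
      by (simp add: power2_eq_square algebra_simps)
  qed
  finally show ?thesis .
qed

text \<open>The root condition on \<mu> is exactly feasibility of \<open>c\<close>. A feasible point
  whose value is at most that of \<open>c\<close> has gap zero, hence equals
  \<open>c\<close>.\<close>

lemma arg_min_soft:
  assumes "\<gamma> > 0" "d \<in> carrier_vec n" "shrink_sum (($) d) n \<gamma> \<mu> = 1"
    and c: "c \<in> carrier_vec n" "\<And>i. i < n \<Longrightarrow> c $ i = soft \<gamma> (d $ i - \<mu>)"
  shows "{x. is_arg_min (objective d \<gamma>) (feasible n) x} = {c}"
proof -
  have fc: "feasible n c"
    using assms by (auto simp: feasible_def scalar_prod_def ones_vec_def atLeast0LessThan shrink_sum_def)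
  note gap = objective_gap[OF assms(1) fc _ assms(2) c(2)]
  have le: "objective d \<gamma> c \<le> objective d \<gamma> x" if "feasible n x" for x
  proof -
    have "0 \<le> (\<Sum>i<n. 1 / 2 * (x $ i - c $ i)\<^sup>2)" by (intro sum_nonneg) auto
    then show ?thesis using gap[OF that] by linarith
  qed
  have "x = c" if "is_arg_min (objective d \<gamma>) (feasible n) x" for x
  proof -
    have fx: "feasible n x" and "objective d \<gamma> x \<le> objective d \<gamma> c"
      using that fc by (auto simp: is_arg_min_linorder)
    then have "(\<Sum>i<n. 1 / 2 * (x $ i - c $ i)\<^sup>2) \<le> 0" using gap[OF fx] by linarith
    moreover have "0 \<le> (\<Sum>i<n. 1 / 2 * (x $ i - c $ i)\<^sup>2)" by (intro sum_nonneg) auto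
    ultimately have "(\<Sum>i<n. 1 / 2 * (x $ i - c $ i)\<^sup>2) = 0" by linarith
    then have "\<And>i. i < n \<Longrightarrow> x $ i = c $ i" by (subst (asm) sum_nonneg_eq_0_iff) auto
    then show ?thesis using fx c(1) by (intro eq_vecI) (auto simp: feasible_def)
  qed
  moreover have "is_arg_min (objective d \<gamma>) (feasible n) c"
    using fc le by (simp add: is_arg_min_linorder)
  ultimately show ?thesis by blast
qed

section \<open>The program\<close>

text \<open>Registers are never numbered 1, since the simplifier rewrites \<open>1\<close> to \<open>Suc 0\<close>.\<close>

abbreviation (input) "iN \<equiv> 0 :: nat"
abbreviation (input) "iOne \<equiv> 2 :: nat"
abbreviation (input) "iM \<equiv> 3 :: nat"
abbreviation (input) "iW \<equiv> 4 :: nat"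
abbreviation (input) "iP \<equiv> 5 :: nat"
abbreviation (input) "iQ \<equiv> 6 :: nat"
abbreviation (input) "iE \<equiv> 7 :: nat"
abbreviation (input) "iI \<equiv> 8 :: nat"
abbreviation (input) "iJ \<equiv> 9 :: nat"
abbreviation (input) "iMid \<equiv> 10 :: nat"
abbreviation (input) "iF \<equiv> 11 :: nat"
abbreviation (input) "iLo \<equiv> 12 :: nat"
abbreviation (input) "iH \<equiv> 13 :: nat"
abbreviation (input) "iT \<equiv> 14 :: nat"
abbreviation (input) "iK \<equiv> 15 :: nat"
abbreviation (input) "rG \<equiv> 0 :: nat"
abbreviation (input) "rV \<equiv> 2 :: nat"
abbreviation (input) "rX \<equiv> 3 :: nat"
abbreviation (input) "rY \<equiv> 4 :: nat"
abbreviation (input) "rS \<equiv> 5 :: nat"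
abbreviation (input) "rOne \<equiv> 6 :: nat"
abbreviation (input) "rZ \<equiv> 7 :: nat"
abbreviation (input) "rL \<equiv> 8 :: nat"
abbreviation (input) "rA \<equiv> 9 :: nat"

section \<open>Evaluation of the dual function in linear time\<close>

definition evaluate_body :: com where
  "evaluate_body = block [Load rX 0 iK, RSub rX rX rV, RSub rY rX rG] ;;
    Cond (RLess rY rZ)
      (Instr (RAdd rY rX rG) ;; Cond (RLess rZ rY) (Instr (RCopy rY rZ)) Skip)
      Skip ;;
    block [Store 1 iK rY, RAdd rS rS rY, IAdd iK iK iOne]"

text \<open>One pass yields both \<open>g\<close> at \<open>rV\<close>, in \<open>rS\<close>, and
  the thresholded vector, in array 1. Hence evaluating at the multiplier also writes the
  output.\<close>

definition evaluate :: com where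
  "evaluate = block [IConst iK 0, RConst rS 0] ;; While (ILess iK iN) evaluate_body"

lemma runs_evaluate:
  assumes "ireg s iN = n" "ireg s iOne = 1" "rreg s rZ = 0" "rreg s rG = \<gamma>" "rreg s rV = v"
    "arr s 0 = D" "T \<ge> 11 * n + 3"
  shows "runs evaluate s T (\<lambda>s'. frame {iK} {rX, rY, rS} {1} s s' \<and>
    rreg s' rS = shrink_sum D n \<gamma> v \<and> (\<forall>i<n. arr s' 1 i = soft \<gamma> (D i - v)))"
    (is "runs _ s T ?Q")
proof -
  let ?I = "\<lambda>i s'. frame {iK} {rX, rY, rS} {1} s s' \<and> ireg s' iK = i \<and>
    rreg s' rS = shrink_sum D i \<gamma> v \<and> (\<forall>k<i. arr s' 1 k = soft \<gamma> (D k - v))"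
  let ?s = "exec (RConst rS 0) (exec (IConst iK 0) s)"
  have "runs (While (ILess iK iN) evaluate_body) ?s (n * Suc 10 + 1) (?I n)"
  proof (rule runs_While)
    show "?I 0 ?s" by (auto simp: frame_def shrink_sum_def)
  next
    fix i s' assume I: "i < n" "?I i s'"
    note fr = frame_same[OF conjunct1[OF I(2)]]
    show "holds (ILess iK iN) s'" using I by (simp add: fr assms)
    \<comment> \<open>The longest path has 3 instructions, 2 tests each followed by one instruction,
      and 3 final instructions.\<close>
    show "runs evaluate_body s' 10 (?I (Suc i))"
      using I assms(1-6)
      by (simp add: runs_simps fr evaluate_body_def)
        (auto simp: frame_def shrink_sum_def soft_def less_Suc_eq)
  next
    fix s' assume "?I n s'"
    then show "\<not> holds (ILess iK iN) s'" using assms by (auto simp: frame_def)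
  qed
  then have "runs (While (ILess iK iN) evaluate_body) ?s (11 * n + 1) ?Q"
    by (rule runs_mono) auto
  then show ?thesis
    unfolding evaluate_def using assms(7) by (intro runs_block_Seq) auto
qed

subsection \<open>Merge sort\<close>

text \<open>Run boundaries are the multiples of \<open>w\<close> counted from index 0, not from
  \<open>x\<close>; only neighbours across a boundary are exempt. As the levels are aligned,
  divisibility describes the runs.\<close>

definition block_sorted :: "(nat \<Rightarrow> real) \<Rightarrow> nat \<Rightarrow> nat \<Rightarrow> nat \<Rightarrow> bool" where
  "block_sorted a x y w \<longleftrightarrow> (\<forall>k. x \<le> k \<longrightarrow> Suc k < y \<longrightarrow> \<not> w dvd Suc k \<longrightarrow> a k \<le> a (Suc k))"

definition step_sorted :: "(nat \<Rightarrow> real) \<Rightarrow> nat \<Rightarrow> nat \<Rightarrow> bool" where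
  "step_sorted a x y \<longleftrightarrow> (\<forall>k. x \<le> k \<longrightarrow> Suc k < y \<longrightarrow> a k \<le> a (Suc k))"

lemma step_sorted_mono:
  assumes "step_sorted a x y" "x \<le> i" "i \<le> j" "j < y"
  shows "a i \<le> a j"
  using assms(3,4)
proof (induction j rule: dec_induct)
  case (step k)
  then have "a k \<le> a (Suc k)" using assms unfolding step_sorted_def by auto
  with step show ?case by auto
qed simp

text \<open>State of merging \<open>a0\<close> on \<open>{x..<m}\<close> and \<open>{m..<y}\<close> to position \<open>z\<close>, when the two runs
  have been consumed up to \<open>i\<close> and \<open>j\<close>.\<close>

definition merging :: "(nat \<Rightarrow> real) \<Rightarrow> nat \<Rightarrow> nat \<Rightarrow> nat \<Rightarrow> nat \<Rightarrow> nat \<Rightarrow> nat \<Rightarrow> nat \<Rightarrow>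
    (nat \<Rightarrow> real) \<Rightarrow> bool" where
  "merging a0 x m y z i j q a \<longleftrightarrow> x \<le> i \<and> i \<le> m \<and> m \<le> j \<and> j \<le> y \<and> q + x + m = z + i + j \<and>
    (\<forall>k<z. a k = a0 k) \<and> step_sorted a z q \<and>
    (z < q \<longrightarrow> i < m \<longrightarrow> a (q - 1) \<le> a0 i) \<and> (z < q \<longrightarrow> j < y \<longrightarrow> a (q - 1) \<le> a0 j) \<and>
    a ` {z..<q} = a0 ` ({x..<i} \<union> {m..<j})"

lemma image_update_snoc:
  assumes "z \<le> (q :: nat)"
  shows "(a(q := v)) ` {z..<Suc q} = insert v (a ` {z..<q})"
  using assms by (auto simp: image_iff atLeastLessThanSuc)

lemma step_sorted_snoc:
  assumes "step_sorted a z q" "z < q \<Longrightarrow> a (q - 1) \<le> v"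
  shows "step_sorted (a(q := v)) z (Suc q)"
  unfolding step_sorted_def
proof (intro allI impI)
  fix k assume "z \<le> k" "Suc k < Suc q"
  then show "(a(q := v)) k \<le> (a(q := v)) (Suc k)"
    using assms by (cases "Suc k = q") (auto simp: step_sorted_def)
qed

text \<open>The head taken is at most both heads that remain: its successor because the left run is
  sorted, the other one by the comparison. So the bounds on the last entry written persist.\<close>

lemma merging_left:
  assumes "merging a0 x m y z i j q a" "i < m" "j < y \<Longrightarrow> a0 i \<le> a0 j" "step_sorted a0 x m"
  shows "merging a0 x m y z (Suc i) j (Suc q) (a(q := a0 i))"
proof -
  have f: "x \<le> i" "i \<le> m" "m \<le> j" "j \<le> y" "q + x + m = z + i + j" "\<forall>k<z. a k = a0 k"
    "step_sorted a z q" "z < q \<longrightarrow> i < m \<longrightarrow> a (q - 1) \<le> a0 i"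
    "z < q \<longrightarrow> j < y \<longrightarrow> a (q - 1) \<le> a0 j" "a ` {z..<q} = a0 ` ({x..<i} \<union> {m..<j})"
    using assms(1) unfolding merging_def by blast+
  then have "z \<le> q" by linarith
  have "(a(q := a0 i)) ` {z..<Suc q} = insert (a0 i) (a ` {z..<q})"
    using \<open>z \<le> q\<close> by (rule image_update_snoc)
  also have "\<dots> = a0 ` insert i ({x..<i} \<union> {m..<j})" by (simp only: f(10) image_insert)
  also have "insert i ({x..<i} \<union> {m..<j}) = {x..<Suc i} \<union> {m..<j}"
    using f(1-4) by (auto simp: atLeastLessThanSuc)
  finally have "(a(q := a0 i)) ` {z..<Suc q} = a0 ` ({x..<Suc i} \<union> {m..<j})" .
  moreover have "step_sorted (a(q := a0 i)) z (Suc q)"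
    using f assms(2) by (intro step_sorted_snoc) auto
  moreover have "Suc i < m \<longrightarrow> a0 i \<le> a0 (Suc i)"
    using assms(4) f(1-4) unfolding step_sorted_def by auto
  ultimately show ?thesis
    unfolding merging_def using f(1-6) assms(2,3) \<open>z \<le> q\<close> by auto
qed

lemma merging_right:
  assumes "merging a0 x m y z i j q a" "j < y" "i < m \<Longrightarrow> a0 j \<le> a0 i" "step_sorted a0 m y"
  shows "merging a0 x m y z i (Suc j) (Suc q) (a(q := a0 j))"
proof -
  have f: "x \<le> i" "i \<le> m" "m \<le> j" "j \<le> y" "q + x + m = z + i + j" "\<forall>k<z. a k = a0 k"
    "step_sorted a z q" "z < q \<longrightarrow> i < m \<longrightarrow> a (q - 1) \<le> a0 i"
    "z < q \<longrightarrow> j < y \<longrightarrow> a (q - 1) \<le> a0 j" "a ` {z..<q} = a0 ` ({x..<i} \<union> {m..<j})"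
    using assms(1) unfolding merging_def by blast+
  then have "z \<le> q" by linarith
  have "(a(q := a0 j)) ` {z..<Suc q} = insert (a0 j) (a ` {z..<q})"
    using \<open>z \<le> q\<close> by (rule image_update_snoc)
  also have "\<dots> = a0 ` insert j ({x..<i} \<union> {m..<j})" by (simp only: f(10) image_insert)
  also have "insert j ({x..<i} \<union> {m..<j}) = {x..<i} \<union> {m..<Suc j}"
    using f(1-4) by (auto simp: atLeastLessThanSuc)
  finally have "(a(q := a0 j)) ` {z..<Suc q} = a0 ` ({x..<i} \<union> {m..<Suc j})" .
  moreover have "step_sorted (a(q := a0 j)) z (Suc q)"
    using f assms(2) by (intro step_sorted_snoc) auto
  moreover have "Suc j < y \<longrightarrow> a0 j \<le> a0 (Suc j)"
    using assms(4) f(1-4) unfolding step_sorted_def by auto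
  ultimately show ?thesis
    unfolding merging_def using f(1-6) assms(2,3) \<open>z \<le> q\<close> by auto
qed

section \<open>The merging loop\<close>

definition take_left :: com where
  "take_left = block [Store 2 iQ rX, IAdd iI iI iOne]"

definition take_right :: com where
  "take_right = block [Store 2 iQ rY, IAdd iJ iJ iOne]"

text \<open>Both heads are loaded before the runs are tested for exhaustion. During a merge, a value
  read beyond the end of a run is never compared or stored.\<close>

definition merge_body :: com where
  "merge_body = block [Load rX 2 iI, Load rY 2 iJ] ;;
    Cond (ILess iI iMid)
      (Cond (ILess iJ iP) (Cond (RLe rX rY) take_left take_right) take_left)
      take_right ;;
    Instr (IAdd iQ iQ iOne)"

definition merge :: com where
  "merge = While (ILess iQ iF) merge_body"

text \<open>Each round writes one entry, which gives \<open>y - x\<close> rounds of at most 8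
  operations and a test. The target starts at \<open>z \<ge> y\<close>, so the source is never
  overwritten.\<close>

lemma runs_merge:
  assumes s: "ireg s iOne = 1" "ireg s iI = x" "ireg s iMid = m" "ireg s iJ = m" "ireg s iP = y"
    "ireg s iQ = z" "ireg s iF = z + (y - x)" "arr s 2 = a0"
    and xy: "x \<le> m" "m \<le> y" "y \<le> z" "step_sorted a0 x m" "step_sorted a0 m y"
    and T: "T \<ge> (y - x) * 9 + 1"
  shows "runs merge s T (\<lambda>s'. frame {iI, iJ, iQ} {rX, rY} {2} s s' \<and>
    ireg s' iQ = z + (y - x) \<and> (\<forall>k<z. arr s' 2 k = a0 k) \<and>
    step_sorted (arr s' 2) z (z + (y - x)) \<and> arr s' 2 ` {z..<z + (y - x)} = a0 ` {x..<y})"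
proof -
  let ?I = "\<lambda>r s'. frame {iI, iJ, iQ} {rX, rY} {2} s s' \<and> ireg s' iQ = z + r \<and>
    merging a0 x m y z (ireg s' iI) (ireg s' iJ) (z + r) (arr s' 2)"
  have "runs (While (ILess iQ iF) merge_body) s ((y - x) * Suc 8 + 1) (?I (y - x))"
  proof (rule runs_While)
    show "?I 0 s" using s xy by (auto simp: frame_def merging_def step_sorted_def)
  next
    fix r s' assume I: "r < y - x" "?I r s'"
    note fr = frame_same[OF conjunct1[OF I(2)]]
    define i j a where "i = ireg s' iI" and "j = ireg s' iJ" and "a = arr s' 2"
    have mg: "merging a0 x m y z i j (z + r) a" using I(2) by (simp add: i_def j_def a_def)
    have src: "i < m \<Longrightarrow> a i = a0 i" "j < y \<Longrightarrow> a j = a0 j"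
      using mg xy by (auto simp: merging_def)
    \<comment> \<open>Only \<open>r\<close> entries have been written, fewer than the two runs
      contain, so one of them still has a head.\<close>
    have one: "i < m \<or> j < y" using mg I(1) by (auto simp: merging_def)
    show "holds (ILess iQ iF) s'" using I s by (simp add: fr)
    have fr': "frame {iI, iJ, iQ} {rX, rY} {2} s s'" using I(2) by simp
    have L: "merging a0 x m y z (Suc i) j (Suc (z + r)) (a(z + r := a i))"
      if "i < m" "j < y \<Longrightarrow> a i \<le> a j" using merging_left[OF mg] that src xy by auto
    have R: "merging a0 x m y z i (Suc j) (Suc (z + r)) (a(z + r := a j))"
      if "j < y" "i < m \<Longrightarrow> a j \<le> a i" using merging_right[OF mg] that src xy by auto
    show "runs merge_body s' 8 (?I (Suc r))"
      using I s one L R unfolding i_def j_def a_def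
      by (simp add: runs_simps fr take_left_def take_right_def merge_body_def) (auto simp: frame_def)
  next
    fix s' assume "?I (y - x) s'"
    then show "\<not> holds (ILess iQ iF) s'" using s by (auto simp: frame_def)
  qed
  then show ?thesis unfolding merge_def
  proof (rule runs_mono)
    fix s' assume I: "?I (y - x) s'"
    then have "ireg s' iI = m" "ireg s' iJ = y" using xy by (auto simp: merging_def)
    moreover have "{x..<m} \<union> {m..<y} = {x..<y}" using xy by auto
    ultimately show "frame {iI, iJ, iQ} {rX, rY} {2} s s' \<and>
    ireg s' iQ = z + (y - x) \<and> (\<forall>k<z. arr s' 2 k = a0 k) \<and>
    step_sorted (arr s' 2) z (z + (y - x)) \<and> arr s' 2 ` {z..<z + (y - x)} = a0 ` {x..<y}"
      using I by (auto simp: merging_def)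
  qed (use T in auto)
qed

section \<open>Runs of equal length and passes over them\<close>

lemma block_sorted_run:
  assumes "block_sorted a x y w" "w dvd i" "x \<le> i" "i + w \<le> y"
  shows "step_sorted a i (i + w)"
  unfolding step_sorted_def
proof (intro allI impI)
  fix k assume k: "i \<le> k" "Suc k < i + w"
  \<comment> \<open>An aligned window of length \<open>w\<close> has no multiple of \<open>w\<close>
    in its interior.\<close>
  have "\<not> w dvd Suc k"
  proof
    assume "w dvd Suc k"
    then have "w dvd Suc k - i" using assms(2) by (rule dvd_diff_nat)
    then show False using k by (auto dest: dvd_imp_le)
  qed
  then show "a k \<le> a (Suc k)" using assms k by (auto simp: block_sorted_def)
qed

text \<open>No order is required across the run boundary \<open>z\<close>, so it suffices that the
  appended run is sorted.\<close>

lemma block_sorted_extend: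
  assumes "block_sorted a x z w" "w dvd z" "step_sorted a' z (z + w)" "\<And>k. k < z \<Longrightarrow> a' k = a k"
  shows "block_sorted a' x (z + w) w"
  unfolding block_sorted_def
proof (intro allI impI)
  fix k assume k: "x \<le> k" "Suc k < z + w" "\<not> w dvd Suc k"
  then have "Suc k \<noteq> z" using assms(2) by auto
  then consider "Suc k < z" | "z \<le> k" by linarith
  then show "a' k \<le> a' (Suc k)"
    using assms k by cases (auto simp: block_sorted_def step_sorted_def)
qed

text \<open>\<open>iP\<close> is advanced past both runs before \<open>iF\<close> is set; the end of
  the target lies exactly \<open>M\<close> above the end of the source.\<close>

definition merge_pair :: com where
  "merge_pair = block [ICopy iI iP, IAdd iMid iP iW, ICopy iJ iMid, IAdd iP iMid iW,
    IAdd iF iP iM] ;; merge"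

lemma runs_merge_pair:
  assumes s: "ireg s iOne = 1" "ireg s iM = M" "ireg s iW = w" "ireg s iP = x" "ireg s iQ = x + M"
    "arr s 2 = a0"
    and xw: "2 * w \<le> M" "step_sorted a0 x (x + w)" "step_sorted a0 (x + w) (x + w + w)"
    and T: "T \<ge> 18 * w + 6"
  shows "runs merge_pair s T (\<lambda>s'. frame {iP, iQ, iI, iJ, iMid, iF} {rX, rY} {2} s s' \<and>
    ireg s' iP = x + 2 * w \<and> ireg s' iQ = x + M + 2 * w \<and> (\<forall>k<x + M. arr s' 2 k = a0 k) \<and>
    step_sorted (arr s' 2) (x + M) (x + M + 2 * w) \<and>
    arr s' 2 ` {x + M..<x + M + 2 * w} = a0 ` {x..<x + 2 * w})"
    (is "runs _ s T ?Q")
proof -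
  let ?s = "fold exec [ICopy iI iP, IAdd iMid iP iW, ICopy iJ iMid, IAdd iP iMid iW, IAdd iF iP iM] s"
  have e: "x + w + w - x = 2 * w" "x + w + w = x + 2 * w" by auto
  have "runs merge ?s (18 * w + 1) ?Q"
    by (rule runs_mono[OF runs_merge[where x = x and m = "x + w" and y = "x + w + w"
            and z = "x + M" and ?a0.0 = a0 and T = "18 * w + 1"]])
      (use s xw in \<open>simp_all only: e, auto simp: frame_def\<close>)
  then show ?thesis unfolding merge_pair_def using T by (intro runs_block_Seq) auto
qed

definition merge_pass :: com where
  "merge_pass = block [ICopy iE iQ] ;; While (ILess iP iE) merge_pair"

text \<open>The level at \<open>x\<close> is rewritten at \<open>x + M\<close> with runs of twice
  the length. \<open>iP\<close> and \<open>iQ\<close> end where the next pass has to start.\<close>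

lemma runs_merge_pass:
  assumes s: "ireg s iOne = 1" "ireg s iM = M" "ireg s iW = w" "ireg s iP = x" "ireg s iQ = x + M"
    "arr s 2 = a0"
    and B: "M = B * (2 * w)" "w > 0" "2 * w dvd x" "block_sorted a0 x (x + M) w"
    and T: "T \<ge> 13 * M + 2"
  shows "runs merge_pass s T (\<lambda>s'. frame {iP, iQ, iE, iI, iJ, iMid, iF} {rX, rY} {2} s s' \<and>
    ireg s' iP = x + M \<and> ireg s' iQ = x + M + M \<and>
    block_sorted (arr s' 2) (x + M) (x + M + M) (2 * w) \<and>
    arr s' 2 ` {x + M..<x + M + M} = a0 ` {x..<x + M})"
    (is "runs _ s T ?Q")
proof -
  let ?I = "\<lambda>b s'. frame {iP, iQ, iE, iI, iJ, iMid, iF} {rX, rY} {2} s s' \<and>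
    ireg s' iP = x + b * (2 * w) \<and> ireg s' iQ = x + b * (2 * w) + M \<and> ireg s' iE = x + M \<and>
    (\<forall>k<x + M. arr s' 2 k = a0 k) \<and>
    block_sorted (arr s' 2) (x + M) (x + M + b * (2 * w)) (2 * w) \<and>
    arr s' 2 ` {x + M..<x + M + b * (2 * w)} = a0 ` {x..<x + b * (2 * w)}"
  let ?s = "fold exec [ICopy iE iQ] s"
  have "runs (While (ILess iP iE) merge_pair) ?s (B * Suc (18 * w + 6) + 1) (?I B)"
  proof (rule runs_While)
    show "?I 0 ?s" using s by (auto simp: frame_def block_sorted_def)
  next
    fix b s' assume b: "b < B" and I: "?I b s'"
    define y where "y = x + b * (2 * w)"
    note fr = frame_same[OF conjunct1[OF I]]
    have "Suc b * (2 * w) \<le> B * (2 * w)" using b by (intro mult_right_mono) auto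
    then have le: "y + 2 * w \<le> x + M" using B by (simp add: y_def)
    show "holds (ILess iP iE) s'" using I le B(2) by (simp add: y_def)
    have wy: "2 * w dvd y" "w dvd y" "w dvd y + w"
      using B(3) by (auto simp: y_def intro: dvd_trans[of w "2 * w" x])
    have "step_sorted a0 y (y + w)" "step_sorted a0 (y + w) (y + w + w)"
      using block_sorted_run[OF B(4) wy(2)] block_sorted_run[OF B(4) wy(3)] le by (auto simp: y_def)
    \<comment> \<open>The rounds so far wrote only from \<open>x + M\<close> on, so the source level
      is intact.\<close>
    moreover have "step_sorted (arr s' 2) u v" if "step_sorted a0 u v" "v \<le> x + M" for u v
      using that I by (auto simp: step_sorted_def)
    ultimately have srt: "step_sorted (arr s' 2) y (y + w)" "step_sorted (arr s' 2) (y + w) (y + w + w)"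
      using le by auto
    have "runs merge_pair s' (18 * w + 6) (\<lambda>r. frame {iP, iQ, iI, iJ, iMid, iF} {rX, rY} {2} s' r \<and>
      ireg r iP = y + 2 * w \<and> ireg r iQ = y + M + 2 * w \<and> (\<forall>k<y + M. arr r 2 k = arr s' 2 k) \<and>
      step_sorted (arr r 2) (y + M) (y + M + 2 * w) \<and>
      arr r 2 ` {y + M..<y + M + 2 * w} = arr s' 2 ` {y..<y + 2 * w})"
      by (rule runs_merge_pair) (use I srt le in \<open>auto simp: fr s y_def\<close>)
    then show "runs merge_pair s' (18 * w + 6) (?I (Suc b))"
    proof (rule runs_mono)
      fix r assume r: "frame {iP, iQ, iI, iJ, iMid, iF} {rX, rY} {2} s' r \<and>
        ireg r iP = y + 2 * w \<and> ireg r iQ = y + M + 2 * w \<and> (\<forall>k<y + M. arr r 2 k = arr s' 2 k) \<and>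
        step_sorted (arr r 2) (y + M) (y + M + 2 * w) \<and>
        arr r 2 ` {y + M..<y + M + 2 * w} = arr s' 2 ` {y..<y + 2 * w}"
      have yM: "x + M + b * (2 * w) = y + M" by (simp add: y_def)
      have "2 * w dvd y + M" using wy(1) B(1) by auto
      then have bs: "block_sorted (arr r 2) (x + M) (y + M + 2 * w) (2 * w)"
        using r I unfolding yM by (intro block_sorted_extend[of "arr s' 2"]) auto
      have "arr r 2 ` {x + M..<y + M + 2 * w} =
          arr r 2 ` {x + M..<y + M} \<union> arr r 2 ` {y + M..<y + M + 2 * w}"
        unfolding image_Un[symmetric] by (rule arg_cong[where f = "image _"]) (auto simp: y_def)
      also have "arr r 2 ` {x + M..<y + M} = arr s' 2 ` {x + M..<y + M}"
        using r by (intro image_cong) auto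
      also have "\<dots> = a0 ` {x..<y}" using I unfolding yM by (simp add: y_def)
      also have "arr r 2 ` {y + M..<y + M + 2 * w} = a0 ` {y..<y + 2 * w}"
        using r I le by (auto intro!: image_cong)
      also have "a0 ` {x..<y} \<union> a0 ` {y..<y + 2 * w} = a0 ` {x..<y + 2 * w}"
        unfolding image_Un[symmetric] by (rule arg_cong[where f = "image _"]) (auto simp: y_def)
      finally have im: "arr r 2 ` {x + M..<y + M + 2 * w} = a0 ` {x..<y + 2 * w}" .
      have fr2: "frame {iP, iQ, iE, iI, iJ, iMid, iF} {rX, rY} {2} s r"
        by (rule frame_trans[OF conjunct1[OF I] conjunct1[OF r]]) auto
      have e: "x + Suc b * (2 * w) = y + 2 * w" "x + M + Suc b * (2 * w) = y + M + 2 * w"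
        by (auto simp: y_def)
      show "?I (Suc b) r"
        unfolding e using r I fr2 bs im frame_ireg[OF conjunct1[OF r], of iE]
        by (auto simp: y_def)
    qed simp
  next
    fix s' assume "?I B s'"
    then show "\<not> holds (ILess iP iE) s'" using B(1) by simp
  qed
  moreover have "B * Suc (18 * w + 6) \<le> 13 * M"
  proof -
    \<comment> \<open>Merging costs 9 operations per entry, with an overhead of 7 per pair of runs;
      there are at most \<open>M / 2\<close> pairs.\<close>
    have "B * Suc (18 * w + 6) = 9 * M + 7 * B" using B(1) by (simp add: algebra_simps)
    moreover have "2 * B \<le> M" using B(1,2) by (cases w) auto
    ultimately show ?thesis by linarith
  qed
  ultimately have "runs (While (ILess iP iE) merge_pair) ?s (13 * M + 1) ?Q"
    by (elim runs_mono) (use B(1) in \<open>auto simp: add_ac\<close>)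
  then show ?thesis unfolding merge_pass_def using T by (intro runs_block_Seq) auto
qed

definition merge_sort :: com where
  "merge_sort = block [IConst iP 0, ICopy iQ iM, IConst iW 1] ;;
    While (ILess iW iM) (merge_pass ;; Instr (IAdd iW iW iW))"

text \<open>Level \<open>l\<close> has sorted runs of length \<open>2 ^ l\<close>, so level
  \<open>K\<close> is a single run. Tracking the set of values is enough for breakpoints.\<close>

lemma runs_merge_sort:
  assumes s: "ireg s iOne = 1" "ireg s iM = M" "arr s 2 = a0" and M: "M = 2 ^ K"
    and T: "T \<ge> K * (13 * M + 4) + 4"
  shows "runs merge_sort s T (\<lambda>s'. frame {iW, iP, iQ, iE, iI, iJ, iMid, iF} {rX, rY} {2} s s' \<and>
    ireg s' iW = M \<and> ireg s' iP = K * M \<and> step_sorted (arr s' 2) (K * M) (K * M + M) \<and>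
    arr s' 2 ` {K * M..<K * M + M} = a0 ` {0..<M})"
    (is "runs _ s T ?Q")
proof -
  let ?I = "\<lambda>l s'. frame {iW, iP, iQ, iE, iI, iJ, iMid, iF} {rX, rY} {2} s s' \<and>
    ireg s' iW = 2 ^ l \<and> ireg s' iP = l * M \<and> ireg s' iQ = l * M + M \<and>
    block_sorted (arr s' 2) (l * M) (l * M + M) (2 ^ l) \<and>
    arr s' 2 ` {l * M..<l * M + M} = a0 ` {0..<M}"
  let ?s = "fold exec [IConst iP 0, ICopy iQ iM, IConst iW 1] s"
  have "runs (While (ILess iW iM) (merge_pass ;; Instr (IAdd iW iW iW))) ?s
    (K * Suc (13 * M + 3) + 1) (?I K)"
  proof (rule runs_While)
    show "?I 0 ?s" using s by (auto simp: frame_def block_sorted_def)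
  next
    fix l s' assume l: "l < K" and I: "?I l s'"
    note fr = frame_same[OF conjunct1[OF I]]
    have less: "(2 :: nat) ^ l < M" using l M by simp
    then show "holds (ILess iW iM) s'" using I by (simp add: fr s)
    \<comment> \<open>Level \<open>l\<close> consists of \<open>2 ^ (K - l - 1)\<close> pairs of
      runs.\<close>
    have M': "M = 2 ^ (K - l - 1) * (2 * 2 ^ l)"
      using l unfolding M by (simp flip: power_add power_Suc)
    have "2 * 2 ^ l dvd l * M" by (subst M') simp
    then have "runs merge_pass s' (13 * M + 2)
      (\<lambda>r. frame {iP, iQ, iE, iI, iJ, iMid, iF} {rX, rY} {2} s' r \<and>
      ireg r iP = l * M + M \<and> ireg r iQ = l * M + M + M \<and>
      block_sorted (arr r 2) (l * M + M) (l * M + M + M) (2 * 2 ^ l) \<and>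
      arr r 2 ` {l * M + M..<l * M + M + M} = arr s' 2 ` {l * M..<l * M + M})"
      by (intro runs_merge_pass[OF _ _ _ _ _ _ M']) (use I in \<open>auto simp: fr s\<close>)
    then show "runs (merge_pass ;; Instr (IAdd iW iW iW)) s' (13 * M + 3) (?I (Suc l))"
    proof (rule runs_Seq[where ?T2.0 = 1])
      fix r assume r: "frame {iP, iQ, iE, iI, iJ, iMid, iF} {rX, rY} {2} s' r \<and>
        ireg r iP = l * M + M \<and> ireg r iQ = l * M + M + M \<and>
        block_sorted (arr r 2) (l * M + M) (l * M + M + M) (2 * 2 ^ l) \<and>
        arr r 2 ` {l * M + M..<l * M + M + M} = arr s' 2 ` {l * M..<l * M + M}"
      have fr2: "frame {iW, iP, iQ, iE, iI, iJ, iMid, iF} {rX, rY} {2} s r"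
        by (rule frame_trans[OF conjunct1[OF I] conjunct1[OF r]]) auto
      have w: "ireg r iW = 2 ^ l" using I frame_ireg[OF conjunct1[OF r], of iW] by simp
      have e: "Suc l * M = l * M + M" by simp
      show "runs (Instr (IAdd iW iW iW)) r 1 (?I (Suc l))"
        unfolding e using r I fr2 w by (auto simp: runs_simps frame_def)
    qed simp
  next
    fix s' assume I: "?I K s'"
    then show "\<not> holds (ILess iW iM) s'" using s M by (auto simp: frame_def)
  qed
  then have "runs (While (ILess iW iM) (merge_pass ;; Instr (IAdd iW iW iW))) ?s
    (K * (13 * M + 4) + 1) ?Q"
  proof (rule runs_mono)
    fix s' assume I: "?I K s'"
    have "step_sorted (arr s' 2) (K * M) (K * M + M)"
      using I M by (intro block_sorted_run[of _ "K * M" "K * M + M"]) auto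
    then show "?Q s'" using I M by auto
  qed auto
  then show ?thesis unfolding merge_sort_def using T by (intro runs_block_Seq) auto
qed

subsection \<open>Breakpoints\<close>

definition grow :: com where
  "grow = block [IConst iOne 1, IConst iM 1, IAdd iT iN iN] ;;
    While (ILess iM iT) (Instr (IAdd iM iM iM))"

lemma runs_grow:
  assumes s: "ireg s iN = n" and K: "2 * n \<le> 2 ^ K" "\<And>k. k < K \<Longrightarrow> 2 ^ k < 2 * n"
    and T: "T \<ge> 2 * K + 4"
  shows "runs grow s T (\<lambda>s'. frame {iOne, iM, iT} {} {} s s' \<and>
    ireg s' iOne = 1 \<and> ireg s' iM = 2 ^ K)"
    (is "runs _ s T ?Q")
proof -
  let ?I = "\<lambda>k s'. frame {iOne, iM, iT} {} {} s s' \<and> ireg s' iOne = 1 \<and> ireg s' iM = 2 ^ k \<and>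
    ireg s' iT = 2 * n"
  let ?s = "fold exec [IConst iOne 1, IConst iM 1, IAdd iT iN iN] s"
  have "runs (While (ILess iM iT) (Instr (IAdd iM iM iM))) ?s (K * Suc 1 + 1) (?I K)"
    by (rule runs_While) (use s K in \<open>auto simp: frame_def runs_simps not_less\<close>)
  then have "runs (While (ILess iM iT) (Instr (IAdd iM iM iM))) ?s (2 * K + 1) ?Q"
    by (rule runs_mono) auto
  then show ?thesis unfolding grow_def using T by (intro runs_block_Seq) auto
qed

definition fill_body :: com where
  "fill_body = block [Load rX 0 iK, RSub rY rX rG, Store 2 iK rY, RAdd rY rX rG, IAdd iT iK iN,
    Store 2 iT rY, IAdd iK iK iOne]"

definition fill :: com where
  "fill = block [IConst iK 0, RConst rOne 1] ;; While (ILess iK iN) fill_body"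

text \<open>Nothing is claimed about the padding: the search only needs every breakpoint to
  occur.\<close>

lemma runs_fill:
  assumes s: "ireg s iN = n" "ireg s iOne = 1" "rreg s rG = \<gamma>" "arr s 0 = D"
    and T: "T \<ge> 8 * n + 3"
  shows "runs fill s T (\<lambda>s'. frame {iK, iT} {rX, rY, rOne} {2} s s' \<and> rreg s' rOne = 1 \<and>
    (\<forall>k<n. arr s' 2 k = D k - \<gamma> \<and> arr s' 2 (k + n) = D k + \<gamma>))"
    (is "runs _ s T ?Q")
proof -
  let ?I = "\<lambda>i s'. frame {iK, iT} {rX, rY, rOne} {2} s s' \<and> ireg s' iK = i \<and> rreg s' rOne = 1 \<and>
    (\<forall>k<i. arr s' 2 k = D k - \<gamma> \<and> arr s' 2 (k + n) = D k + \<gamma>)"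
  let ?s = "fold exec [IConst iK 0, RConst rOne 1] s"
  have "runs (While (ILess iK iN) fill_body) ?s (n * Suc 7 + 1) (?I n)"
  proof (rule runs_While[where I = ?I])
    show "?I 0 ?s" by (auto simp: frame_def)
  next
    fix i s' assume I: "i < n" "?I i s'"
    note fr = frame_same[OF conjunct1[OF I(2)]]
    show "holds (ILess iK iN) s'" using I s by (simp add: fr)
    show "runs fill_body s' 7 (?I (Suc i))"
      using I s by (simp add: runs_simps fr fill_body_def) (auto simp: frame_def less_Suc_eq)
  next
    fix s' assume "?I n s'"
    then show "\<not> holds (ILess iK iN) s'" using s by (auto simp: frame_def)
  qed
  then have "runs (While (ILess iK iN) fill_body) ?s (8 * n + 1) ?Q"
    by (rule runs_mono) auto
  then show ?thesis unfolding fill_def using T by (intro runs_block_Seq) auto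
qed

subsection \<open>Binary search\<close>

text \<open>The machine cannot divide counters, so \<open>iH\<close> counts up until its double
  reaches \<open>iW\<close>. The linear cost is of no higher order than that of evaluating
  \<open>g\<close>.\<close>

definition halve :: com where
  "halve = block [IConst iH 0, IConst iT 0] ;;
    While (ILess iT iW) (block [IAdd iH iH iOne, IAdd iT iH iH])"

lemma runs_halve:
  assumes s: "ireg s iOne = 1" "ireg s iW = 2 * v" and T: "T \<ge> 3 * v + 3"
  shows "runs halve s T (\<lambda>s'. frame {iH, iT} {} {} s s' \<and> ireg s' iH = v)"
    (is "runs _ s T ?Q")
proof -
  let ?I = "\<lambda>k s'. frame {iH, iT} {} {} s s' \<and> ireg s' iH = k \<and> ireg s' iT = 2 * k"
  let ?s = "fold exec [IConst iH 0, IConst iT 0] s"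
  have "runs (While (ILess iT iW) (block [IAdd iH iH iOne, IAdd iT iH iH])) ?s
      (v * Suc 2 + 1) (?I v)"
    by (rule runs_While) (use s in \<open>auto simp: frame_def runs_simps\<close>)
  then have "runs (While (ILess iT iW) (block [IAdd iH iH iOne, IAdd iT iH iH])) ?s (3 * v + 1) ?Q"
    by (rule runs_mono) auto
  then show ?thesis unfolding halve_def using T by (intro runs_block_Seq) auto
qed

definition search_step :: com where
  "search_step = halve ;; block [IAdd iK iLo iH, Load rV 2 iK] ;; evaluate ;;
    Cond (RLe rOne rS) (Instr (IAdd iLo iLo iH)) Skip ;; Instr (ICopy iW iH)"

lemma runs_search_step:
  assumes s: "ireg s iN = n" "ireg s iOne = 1" "rreg s rZ = 0" "rreg s rG = \<gamma>" "rreg s rOne = 1"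
    "arr s 0 = D" "arr s 2 = b" "ireg s iLo = x" "ireg s iW = 2 * v"
    and T: "T \<ge> 3 * v + 11 * n + 11"
  shows "runs search_step s T (\<lambda>s'. frame {iH, iT, iK, iLo, iW} {rV, rX, rY, rS} {1} s s' \<and>
    ireg s' iW = v \<and>
    ireg s' iLo = (if 1 \<le> shrink_sum D n \<gamma> (b (x + v)) then x + v else x))"
    (is "runs _ s T ?Q")
  unfolding search_step_def
proof (rule runs_Seq[OF runs_halve[OF s(2,9) order_refl], where ?T2.0 = "11 * n + 8"])
  fix r assume r: "frame {iH, iT} {} {} s r \<and> ireg r iH = v"
  note fr = frame_same[OF conjunct1[OF r]]
  let ?r = "fold exec [IAdd iK iLo iH, Load rV 2 iK] r"
  show "runs (block [IAdd iK iLo iH, Load rV 2 iK] ;; evaluate ;;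
    Cond (RLe rOne rS) (Instr (IAdd iLo iLo iH)) Skip ;; Instr (ICopy iW iH)) r (11 * n + 8) ?Q"
  proof (rule runs_block_Seq)
    have "runs evaluate ?r (11 * n + 3) (\<lambda>s'. frame {iK} {rX, rY, rS} {1} ?r s' \<and>
      rreg s' rS = shrink_sum D n \<gamma> (b (x + v)) \<and> (\<forall>i<n. arr s' 1 i = soft \<gamma> (D i - b (x + v))))"
      by (rule runs_evaluate) (use r s in \<open>auto simp: fr\<close>)
    then show "runs (evaluate ;;
      Cond (RLe rOne rS) (Instr (IAdd iLo iLo iH)) Skip ;; Instr (ICopy iW iH)) ?r (11 * n + 6) ?Q"
    proof (rule runs_Seq[where ?T2.0 = 3])
      fix q assume q: "frame {iK} {rX, rY, rS} {1} ?r q \<and>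
        rreg q rS = shrink_sum D n \<gamma> (b (x + v)) \<and> (\<forall>i<n. arr q 1 i = soft \<gamma> (D i - b (x + v)))"
      have "frame {iH, iT, iK} {rV, rX, rY, rS} {1} s q"
        using r q by (auto simp: frame_def)
      then show "runs (Cond (RLe rOne rS) (Instr (IAdd iLo iLo iH)) Skip ;; Instr (ICopy iW iH))
          q 3 ?Q"
        using r q s by (simp add: runs_simps frame_def)
    qed simp
  qed auto
qed (use T in simp)

definition search :: com where
  "search = While (ILess iOne iW) search_step"

text \<open>The invariant is \<open>g \<ge> 1\<close> at the left end and \<open>g \<le> 1\<close>
  at the right end of the bracket. The midpoint replaces the end whose inequality it satisfies, and
  the width shrinks from \<open>2 ^ K\<close> to 1, where the ends are neighbours.\<close>

lemma runs_search:
  assumes s: "ireg s iN = n" "ireg s iOne = 1" "rreg s rZ = 0" "rreg s rG = \<gamma>" "rreg s rOne = 1"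
    "arr s 0 = D" "arr s 2 = b" "ireg s iLo = x" "ireg s iW = M"
    and M: "M = 2 ^ K" "n \<le> M"
    and b: "1 \<le> shrink_sum D n \<gamma> (b x)" "shrink_sum D n \<gamma> (b (x + M)) \<le> 1"
    and T: "T \<ge> K * (14 * M + 12) + 1"
  shows "runs search s T (\<lambda>s'. frame {iH, iT, iK, iLo, iW} {rV, rX, rY, rS} {1} s s' \<and>
    (\<exists>y. ireg s' iLo = y \<and> x \<le> y \<and> Suc y \<le> x + M \<and> 1 \<le> shrink_sum D n \<gamma> (b y) \<and>
      shrink_sum D n \<gamma> (b (Suc y)) \<le> 1))"
    (is "runs _ s T ?Q")
proof -
  let ?I = "\<lambda>k s'. frame {iH, iT, iK, iLo, iW} {rV, rX, rY, rS} {1} s s' \<and>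
    ireg s' iW = 2 ^ (K - k) \<and> x \<le> ireg s' iLo \<and> ireg s' iLo + 2 ^ (K - k) \<le> x + M \<and>
    1 \<le> shrink_sum D n \<gamma> (b (ireg s' iLo)) \<and>
    shrink_sum D n \<gamma> (b (ireg s' iLo + 2 ^ (K - k))) \<le> 1"
  have "runs search s (K * Suc (14 * M + 11) + 1) (?I K)"
    unfolding search_def
  proof (rule runs_While[where I = ?I])
    show "?I 0 s" using s M b by (auto simp: frame_def)
  next
    fix k s' assume k: "k < K" and I: "?I k s'"
    note fr = frame_same[OF conjunct1[OF I]]
    define v :: nat where "v = 2 ^ (K - Suc k)"
    have v: "2 ^ (K - k) = 2 * v" using k by (simp add: v_def flip: power_Suc add: Suc_diff_Suc)
    have "0 < v" by (simp add: v_def)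
    then show "holds (ILess iOne iW) s'" using I v s by (simp add: fr)
    have "v \<le> M" unfolding v_def M by (intro power_increasing) auto
    then have le: "3 * v + 11 * n + 11 \<le> 14 * M + 11" using M(2) by linarith
    have "runs search_step s' (14 * M + 11)
      (\<lambda>r. frame {iH, iT, iK, iLo, iW} {rV, rX, rY, rS} {1} s' r \<and> ireg r iW = v \<and>
      ireg r iLo = (if 1 \<le> shrink_sum D n \<gamma> (b (ireg s' iLo + v)) then ireg s' iLo + v
        else ireg s' iLo))"
      by (rule runs_search_step[OF _ _ _ _ _ _ _ _ _ le]) (use I v in \<open>auto simp: fr s\<close>)
    then show "runs search_step s' (14 * M + 11) (?I (Suc k))"
    proof (rule runs_mono)
      fix r assume r: "frame {iH, iT, iK, iLo, iW} {rV, rX, rY, rS} {1} s' r \<and> ireg r iW = v \<and>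
        ireg r iLo = (if 1 \<le> shrink_sum D n \<gamma> (b (ireg s' iLo + v)) then ireg s' iLo + v
        else ireg s' iLo)"
      have "frame {iH, iT, iK, iLo, iW} {rV, rX, rY, rS} {1} s r"
        by (rule frame_trans[OF conjunct1[OF I] conjunct1[OF r]]) auto
      then show "?I (Suc k) r"
        using r I unfolding v v_def[symmetric] by (auto simp: mult_2 add_ac split: if_splits)
    qed simp
  next
    fix s' assume I: "?I K s'"
    then show "\<not> holds (ILess iOne iW) s'" using s by (auto simp: frame_def)
  qed
  then show ?thesis by (rule runs_mono) (use T in \<open>auto simp: add_ac\<close>)
qed

subsection \<open>Interpolation\<close>

text \<open>The test on \<open>rA\<close>, the difference of the two values of \<open>g\<close>,
  guards the division. The last \<open>evaluate\<close> leaves the output in array 1.\<close>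

definition interpolate :: com where
  "interpolate = block [Load rV 2 iLo, RCopy rL rV] ;; evaluate ;;
    block [RCopy rA rS, IAdd iLo iLo iOne, Load rV 2 iLo] ;; evaluate ;;
    block [RSub rX rA rOne, RSub rA rA rS, RSub rV rV rL] ;;
    Cond (RLess rZ rA) (block [RDiv rX rX rA, RMul rX rX rV, RAdd rV rL rX])
      (Instr (RCopy rV rL)) ;;
    evaluate"

lemma runs_interpolate:
  assumes s: "ireg s iN = n" "ireg s iOne = 1" "rreg s rZ = 0" "rreg s rG = \<gamma>" "rreg s rOne = 1"
    "arr s 0 = D" "arr s 2 = b" "ireg s iLo = y"
    and g: "ga = shrink_sum D n \<gamma> (b y)" "gb = shrink_sum D n \<gamma> (b (Suc y))"
    and v: "v = (if gb < ga then b y + (ga - 1) / (ga - gb) * (b (Suc y) - b y) else b y)"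
    and T: "T \<ge> 33 * n + 21"
  shows "runs interpolate s T (\<lambda>s'. \<forall>i<n. arr s' 1 i = soft \<gamma> (D i - v))"
    (is "runs _ s T ?Q")
  unfolding interpolate_def
proof (rule runs_block_Seq)
  let ?E = "\<lambda>v r s'. frame {iK} {rX, rY, rS} {1} r s' \<and>
    rreg s' rS = shrink_sum D n \<gamma> v \<and> (\<forall>i<n. arr s' 1 i = soft \<gamma> (D i - v))"
  let ?c3 = "Cond (RLess rZ rA) (block [RDiv rX rX rA, RMul rX rX rV, RAdd rV rL rX])
      (Instr (RCopy rV rL)) ;; evaluate"
  let ?c2 = "block [RSub rX rA rOne, RSub rA rA rS, RSub rV rV rL] ;; ?c3"
  let ?c1 = "block [RCopy rA rS, IAdd iLo iLo iOne, Load rV 2 iLo] ;; evaluate ;; ?c2"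
  let ?s = "fold exec [Load rV 2 iLo, RCopy rL rV] s"
  show "runs (evaluate ;; ?c1) ?s (33 * n + 19) ?Q"
  proof (rule runs_Seq[where ?T1.0 = "11 * n + 3" and ?T2.0 = "22 * n + 16"])
    show "runs evaluate ?s (11 * n + 3) (?E (b y) ?s)"
      by (rule runs_evaluate) (use s in auto)
    fix r assume r: "?E (b y) ?s r"
    let ?r = "fold exec [RCopy rA rS, IAdd iLo iLo iOne, Load rV 2 iLo] r"
    show "runs ?c1 r (22 * n + 16) ?Q"
    proof (rule runs_block_Seq)
      show "runs (evaluate ;; ?c2) ?r (22 * n + 13) ?Q"
      proof (rule runs_Seq[where ?T1.0 = "11 * n + 3" and ?T2.0 = "11 * n + 10"])
        show "runs evaluate ?r (11 * n + 3) (?E (b (Suc y)) ?r)"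
          by (rule runs_evaluate) (use s frame_same[OF conjunct1[OF r]] in auto)
        fix q assume q: "?E (b (Suc y)) ?r q"
        have q': "ireg q iN = n" "ireg q iOne = 1" "rreg q rZ = 0" "rreg q rG = \<gamma>" "rreg q rOne = 1"
          "arr q 0 = D" "rreg q rL = b y" "rreg q rV = b (Suc y)" "rreg q rA = ga" "rreg q rS = gb"
          using s g r q by (auto simp: frame_def)
        let ?q = "fold exec [RSub rX rA rOne, RSub rA rA rS, RSub rV rV rL] q"
        show "runs ?c2 q (11 * n + 10) ?Q"
        proof (rule runs_block_Seq)
          have ev: "runs evaluate p (11 * n + 3) ?Q"
            if "ireg p iN = n" "ireg p iOne = 1" "rreg p rZ = 0" "rreg p rG = \<gamma>"
              "rreg p rV = v" "arr p 0 = D" for p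
            by (rule runs_mono[OF runs_evaluate[OF that order_refl]]) auto
          \<comment> \<open>The two branches leave different budgets for the last evaluation, so
            every sufficient \<open>t\<close> is covered.\<close>
          have "runs evaluate p t ?Q"
            if "ireg p iN = n" "ireg p iOne = 1" "rreg p rZ = 0" "rreg p rG = \<gamma>"
              "rreg p rV = v" "arr p 0 = D" "11 * n + 3 \<le> t" for p t
            by (rule runs_mono[OF ev[OF that(1-6)] that(7)])
          then show "runs ?c3 ?q (11 * n + 7) ?Q"
            using q' v by (cases "gb < ga") (simp_all add: runs_simps)
        qed auto
      qed auto
    qed auto
  qed auto
qed (use T in auto)

section \<open>Correctness and cost\<close>

text \<open>At distance 1 below the lower breakpoints each summand is at least 1; this is why the
  sentinel is the smallest entry minus 1.\<close>

lemma shrink_sum_ge_1: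
  assumes "n > 0" "\<And>i. i < n \<Longrightarrow> v + 1 \<le> D i - \<gamma>"
  shows "1 \<le> shrink_sum D n \<gamma> v"
proof -
  have "1 \<le> soft \<gamma> (D i - v)" if "i < n" for i
    using assms(2)[OF that] by (simp add: soft_def)
  then have "(\<Sum>i<n. 1) \<le> shrink_sum D n \<gamma> v"
    unfolding shrink_sum_def by (intro sum_mono) auto
  then show ?thesis using assms(1) by simp
qed

lemma shrink_sum_le_0:
  assumes "\<gamma> > 0" "\<And>i. i < n \<Longrightarrow> D i + \<gamma> \<le> v"
  shows "shrink_sum D n \<gamma> v \<le> 0"
proof -
  have "soft \<gamma> (D i - v) \<le> 0" if "i < n" for i
    using assms(2)[OF that] assms(1) by (simp add: soft_def)
  then show ?thesis unfolding shrink_sum_def by (intro sum_nonpos) auto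
qed

text \<open>The sentinel overwrites the last position before the sorted level. The range from
  \<open>z - 1\<close> to \<open>z - 1 + M\<close> then ends at the last sorted entry and has width
  exactly \<open>M\<close>, as repeated halving requires.\<close>

lemma step_sorted_sentinel:
  assumes a: "step_sorted a z (z + M)" "0 < z" "0 < M" and b: "b = a(z - 1 := a z - 1)"
    and t: "t \<in> a ` {z..<z + M}"
  shows "b (z - 1) + 1 \<le> t" "t \<le> b (z - 1 + M)"
    and "z - 1 \<le> y \<Longrightarrow> Suc y \<le> z - 1 + M \<Longrightarrow> t \<le> b y \<or> b (Suc y) \<le> t"
    and "z - 1 \<le> y \<Longrightarrow> Suc y \<le> z - 1 + M \<Longrightarrow> b y \<le> b (Suc y)"
proof -
  obtain k where k: "t = a k" "z \<le> k" "k < z + M" using t by auto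
  note mono = step_sorted_mono[OF a(1)]
  have bu: "b u = a u" if "z \<le> u" for u using that a(2) by (auto simp: b)
  show "b (z - 1) + 1 \<le> t" using mono[of z k] k by (simp add: b)
  have "a k \<le> a (z - 1 + M)" using mono[of k "z - 1 + M"] k a(2) by auto
  then show "t \<le> b (z - 1 + M)" using bu[of "z - 1 + M"] k(1) a(3) by auto
  assume y: "z - 1 \<le> y" "Suc y \<le> z - 1 + M"
  show "b y \<le> b (Suc y)"
  proof (cases "y = z - 1")
    case True
    then show ?thesis using a(2) by (simp add: b)
  next
    case False
    then have "z \<le> y" "Suc y < z + M" using y a(2) by auto
    then show ?thesis using mono[of y "Suc y"] bu by auto
  qed
  show "t \<le> b y \<or> b (Suc y) \<le> t"
  proof (cases "k \<le> y")
    case True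
    then show ?thesis using mono[of k y] y bu[of y] k by auto
  next
    case False
    then show ?thesis using mono[of "Suc y" k] y bu[of "Suc y"] k by auto
  qed
qed

text \<open>\<open>merge_sort\<close> leaves \<open>iP\<close> at the sorted level and
  \<open>M\<close> in \<open>iW\<close>, which is the initial width of the search. \<open>rZ\<close>
  is never written and keeps its initial 0.\<close>

definition solver :: com where
  "solver = grow ;; fill ;; merge_sort ;;
    block [Load rX 2 iP, RSub rX rX rOne, ISub iLo iP iOne, Store 2 iLo rX] ;;
    search ;; interpolate"

text \<open>The budget is the sum of \<open>2 * K + 4\<close> for \<open>grow\<close>,
  \<open>8 * n + 3\<close> for \<open>fill\<close>, \<open>K * (13 * M + 4) + 4\<close> for sorting,
  4 for the sentinel, \<open>K * (14 * M + 12) + 1\<close> for the search and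
  \<open>33 * n + 21\<close> for the interpolation.\<close>

lemma runs_solver:
  assumes n: "2 \<le> n" and \<gamma>: "\<gamma> > 0"
    and s: "ireg s iN = n" "rreg s rG = \<gamma>" "rreg s rZ = 0" "arr s 0 = D"
    and K: "2 * n \<le> 2 ^ K" "\<And>k. k < K \<Longrightarrow> 2 ^ k < 2 * n" and M: "M = 2 ^ K"
    and T: "T \<ge> 27 * (K * M) + 18 * K + 41 * n + 37"
  shows "runs solver s T (\<lambda>s'. \<exists>\<mu>. shrink_sum D n \<gamma> \<mu> = 1 \<and>
    (\<forall>i<n. arr s' 1 i = soft \<gamma> (D i - \<mu>)))"
    (is "runs _ s T ?Q")
proof -
  \<comment> \<open>Level \<open>K\<close> thus starts at a positive index, which leaves room for
    the sentinel.\<close>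
  have K0: "0 < K" using K(1) n by (cases K) auto
  define z where "z = K * M"
  have z: "0 < z" and M0: "0 < M" and nM: "2 * n \<le> M" using K0 K(1) M by (auto simp: z_def)
  let ?b4 = "[Load rX 2 iP, RSub rX rX rOne, ISub iLo iP iOne, Store 2 iLo rX]"
  have "runs grow s (2 * K + 4) (\<lambda>s'. frame {iOne, iM, iT} {} {} s s' \<and>
      ireg s' iOne = 1 \<and> ireg s' iM = 2 ^ K)"
    by (rule runs_grow) (use s(1) K in auto)
  then show ?thesis unfolding solver_def
  proof (rule runs_Seq)
    fix s1 assume s1: "frame {iOne, iM, iT} {} {} s s1 \<and> ireg s1 iOne = 1 \<and> ireg s1 iM = 2 ^ K"
    have f1: "ireg s1 iN = n" "rreg s1 rG = \<gamma>" "rreg s1 rZ = 0" "arr s1 0 = D"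
      "ireg s1 iOne = 1" "ireg s1 iM = M"
      using s1 s M frame_same[OF conjunct1[OF s1]] by auto
    show "runs (fill ;; merge_sort ;; block ?b4 ;; search ;; interpolate) s1
      (27 * (K * M) + 16 * K + 41 * n + 33) ?Q"
    proof (rule runs_Seq[OF runs_fill[OF f1(1,5,2,4) order_refl]])
      fix s2 assume s2: "frame {iK, iT} {rX, rY, rOne} {2} s1 s2 \<and> rreg s2 rOne = 1 \<and>
        (\<forall>k<n. arr s2 2 k = D k - \<gamma> \<and> arr s2 2 (k + n) = D k + \<gamma>)"
      have f2: "ireg s2 iN = n" "rreg s2 rG = \<gamma>" "rreg s2 rZ = 0" "arr s2 0 = D"
        "ireg s2 iOne = 1" "ireg s2 iM = M" "rreg s2 rOne = 1"
        using s2 f1 frame_same[OF conjunct1[OF s2]] by auto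
      have brk2: "D i - \<gamma> \<in> arr s2 2 ` {0..<M}" "D i + \<gamma> \<in> arr s2 2 ` {0..<M}" if "i < n" for i
        using s2 that nM by (auto intro: image_eqI[of _ _ i] image_eqI[of _ _ "i + n"])
      show "runs (merge_sort ;; block ?b4 ;; search ;; interpolate) s2
        (27 * (K * M) + 16 * K + 33 * n + 30) ?Q"
      proof (rule runs_Seq[OF runs_merge_sort[OF f2(5,6) refl M order_refl]])
        fix s3 assume s3: "frame {iW, iP, iQ, iE, iI, iJ, iMid, iF} {rX, rY} {2} s2 s3 \<and>
          ireg s3 iW = M \<and> ireg s3 iP = K * M \<and> step_sorted (arr s3 2) (K * M) (K * M + M) \<and>
          arr s3 2 ` {K * M..<K * M + M} = arr s2 2 ` {0..<M}"
        have f3: "ireg s3 iN = n" "rreg s3 rG = \<gamma>" "rreg s3 rZ = 0" "arr s3 0 = D"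
          "ireg s3 iOne = 1" "rreg s3 rOne = 1"
          using s3 f2 frame_same[OF conjunct1[OF s3]] by auto
        define b where "b = (arr s3 2)(z - 1 := arr s3 2 z - 1)"
        have srt: "step_sorted (arr s3 2) z (z + M)" using s3 by (simp add: z_def)
        have brk: "D i - \<gamma> \<in> arr s3 2 ` {z..<z + M}" "D i + \<gamma> \<in> arr s3 2 ` {z..<z + M}"
          if "i < n" for i
          using brk2[OF that] s3 by (auto simp: z_def)
        note sentinel = step_sorted_sentinel[OF srt z M0 b_def]
        show "runs (block ?b4 ;; search ;; interpolate) s3 (14 * (K * M) + 12 * K + 33 * n + 26) ?Q"
        proof (rule runs_block_Seq)
          let ?s = "fold exec ?b4 s3"
          have lo: "1 \<le> shrink_sum D n \<gamma> (b (z - 1))"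
            by (rule shrink_sum_ge_1) (use n sentinel(1)[OF brk(1)] in auto)
          have hi: "shrink_sum D n \<gamma> (b (z - 1 + M)) \<le> 1"
            by (rule order_trans[OF shrink_sum_le_0[OF \<gamma>]]) (use sentinel(2)[OF brk(2)] in auto)
          have f4: "ireg ?s iN = n" "ireg ?s iOne = 1" "rreg ?s rZ = 0" "rreg ?s rG = \<gamma>"
            "rreg ?s rOne = 1" "arr ?s 0 = D" "arr ?s 2 = b" "ireg ?s iLo = z - 1" "ireg ?s iW = M"
            using f3 s3 by (simp_all add: b_def z_def)
          have nM': "n \<le> M" using nM by simp
          show "runs (search ;; interpolate) ?s (14 * (K * M) + 12 * K + 33 * n + 22) ?Q"
          proof (rule runs_Seq[OF runs_search[OF f4 M nM' lo hi order_refl]])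
            fix r assume r: "frame {iH, iT, iK, iLo, iW} {rV, rX, rY, rS} {1} ?s r \<and>
              (\<exists>y. ireg r iLo = y \<and> z - 1 \<le> y \<and> Suc y \<le> z - 1 + M \<and>
                1 \<le> shrink_sum D n \<gamma> (b y) \<and> shrink_sum D n \<gamma> (b (Suc y)) \<le> 1)"
            then obtain y where y: "ireg r iLo = y" "z - 1 \<le> y" "Suc y \<le> z - 1 + M"
              "1 \<le> shrink_sum D n \<gamma> (b y)" "shrink_sum D n \<gamma> (b (Suc y)) \<le> 1" by blast
            have f5: "ireg r iN = n" "ireg r iOne = 1" "rreg r rZ = 0" "rreg r rG = \<gamma>"
              "rreg r rOne = 1" "arr r 0 = D" "arr r 2 = b"
              unfolding f4[symmetric]
              by (rule frame_same[OF conjunct1[OF r]], simp)+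
            define ga gb where "ga = shrink_sum D n \<gamma> (b y)" and "gb = shrink_sum D n \<gamma> (b (Suc y))"
            define \<mu> where
              "\<mu> = (if gb < ga then b y + (ga - 1) / (ga - gb) * (b (Suc y) - b y) else b y)"
            have "shrink_sum D n \<gamma> \<mu> = 1"
            proof (cases "gb < ga")
              case True
              have "b y \<le> b (Suc y)" using sentinel(4)[OF brk(1)[of 0]] n y by auto
              then show ?thesis
                using True shrink_sum_interpolate[OF \<gamma> _ y(4,5) sentinel(3)[OF brk(1) y(2,3)]
                    sentinel(3)[OF brk(2) y(2,3)]]
                by (simp add: \<mu>_def ga_def gb_def)
            next
              case False
              \<comment> \<open>Here \<open>ga \<le> gb \<le> 1 \<le> ga\<close>, so the left end is
                already a root.\<close>
              then show ?thesis using y by (simp add: \<mu>_def ga_def gb_def)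
            qed
            moreover have "runs interpolate r (33 * n + 21)
                (\<lambda>s'. \<forall>i<n. arr s' 1 i = soft \<gamma> (D i - \<mu>))"
              by (rule runs_interpolate[OF f5 y(1) ga_def gb_def \<mu>_def order_refl])
            ultimately show "runs interpolate r (33 * n + 21) ?Q"
              by (auto elim: runs_mono)
          qed (simp add: algebra_simps)
        qed auto
      qed (simp add: algebra_simps)
    qed simp
  qed (use T in simp)
qed

section \<open>The padded length and the final operation count\<close>

lemma ex_power_of_two:
  fixes n :: nat
  assumes "2 \<le> n"
  obtains K where "2 * n \<le> 2 ^ K" "\<And>k. k < K \<Longrightarrow> 2 ^ k < 2 * n" "2 \<le> K" "2 ^ K \<le> 4 * n"
proof -
  define K where "K = (LEAST k. 2 * n \<le> 2 ^ k)"
  have "2 * n \<le> 2 ^ (2 * n)" by (simp add: less_imp_le)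
  then have K: "2 * n \<le> 2 ^ K" unfolding K_def by (rule LeastI)
  have less: "2 ^ k < 2 * n" if "k < K" for k
    using not_less_Least[of k "\<lambda>k. 2 * n \<le> 2 ^ k"] that unfolding K_def by auto
  have "(2 :: nat) ^ 2 \<le> 2 ^ K" using K assms by simp
  then have "2 \<le> K" by (simp only: power_increasing_iff)
  \<comment> \<open>By minimality \<open>2 ^ (K - 1) < 2 * n\<close>; doubling gives the
    bound.\<close>
  moreover have "2 ^ K \<le> 4 * n" using less[of "K - 1"] \<open>2 \<le> K\<close> by (cases K) auto
  ultimately show thesis using that K less by blast
qed

theorem proposition4:
  "\<exists>(P :: com) (A :: real). A > 0 \<and>
     (\<forall>n \<ge> 2. \<forall>d \<in> carrier_vec n. \<forall>\<gamma> > 0.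
        \<exists>t s. big_step P (input_state d \<gamma>) t s \<and>
          real t \<le> A * real n * ln (real n) \<and>
          {c. is_arg_min (objective d \<gamma>) (feasible n) c} = {output_vec n s})"
\<comment> \<open>The constant is \<open>50 * 3 * 4 / ln 2\<close>, from
  \<open>t \<le> 50 * (K * M)\<close>, \<open>K \<le> 3 * ln n / ln 2\<close> and
  \<open>M \<le> 4 * n\<close>.\<close>
proof (intro exI[of _ solver] exI[of _ "600 / ln 2"] conjI allI impI ballI)
  fix n :: nat and d :: "real vec" and \<gamma> :: real
  assume n: "2 \<le> n" and d: "d \<in> carrier_vec n" and \<gamma>: "0 < \<gamma>"
  obtain K where K: "2 * n \<le> 2 ^ K" "\<And>k. k < K \<Longrightarrow> 2 ^ k < 2 * n" "2 \<le> K" "2 ^ K \<le> 4 * n"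
    using ex_power_of_two[OF n] by blast
  define M :: nat where "M = 2 ^ K"
  define D where "D = arr (input_state d \<gamma>) 0"
  have D: "D i = d $ i" if "i < n" for i using that d by (simp add: D_def input_state_def)
  have "runs solver (input_state d \<gamma>) (27 * (K * M) + 18 * K + 41 * n + 37)
    (\<lambda>s'. \<exists>\<mu>. shrink_sum D n \<gamma> \<mu> = 1 \<and> (\<forall>i<n. arr s' 1 i = soft \<gamma> (D i - \<mu>)))"
  proof (rule runs_solver[OF n \<gamma> _ _ _ D_def[symmetric] K(1) _ M_def order_refl])
    show "2 ^ k < 2 * n" if "k < K" for k using that by (rule K(2))
  qed (use d in \<open>auto simp: input_state_def\<close>)
  then obtain t s \<mu> where t: "big_step solver (input_state d \<gamma>) t s"
      "t \<le> 27 * (K * M) + 18 * K + 41 * n + 37"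
    and \<mu>: "shrink_sum D n \<gamma> \<mu> = 1" "\<forall>i<n. arr s 1 i = soft \<gamma> (D i - \<mu>)"
    unfolding runs_def by blast
  have "shrink_sum (($) d) n \<gamma> \<mu> = 1"
    using \<mu>(1) D unfolding shrink_sum_def by simp
  then have min: "{c. is_arg_min (objective d \<gamma>) (feasible n) c} = {output_vec n s}"
    by (rule arg_min_soft[OF \<gamma> d]) (use \<mu>(2) D in \<open>auto simp: output_vec_def\<close>)
  \<comment> \<open>These facts bound \<open>18 * K\<close>, \<open>41 * n\<close> and 37 by
    multiples of \<open>K * M\<close>; with the leading 27 the coefficients add up to less than
    47.\<close>
  have "4 \<le> M" "2 * n \<le> M" using K n by (auto simp: M_def)
  moreover from this have "K * 4 \<le> K * M" "2 * M \<le> K * M" "2 * 4 \<le> K * M"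
    using K(3) by (simp_all only: mult_le_mono order_refl)
  ultimately have "t \<le> 50 * (K * M)" using t(2) by linarith
  moreover have "real (2 ^ K) \<le> real (4 * n)" using K(4) by (simp only: of_nat_le_iff)
  then have rK: "2 ^ K \<le> 4 * real n" by simp
  ultimately have "real t \<le> real (50 * (K * M))" by (simp only: of_nat_le_iff)
  also have "\<dots> = 50 * (real K * real M)" by simp
  also have "\<dots> \<le> 50 * ((3 * ln (real n) / ln 2) * (4 * real n))"
  proof (intro mult_left_mono mult_mono)
    have "real K * ln 2 = ln (2 ^ K)" by (simp add: ln_realpow)
    also have "\<dots> \<le> ln (2 ^ 2 * real n)"
      using rK by (intro ln_mono) auto
    also have "\<dots> = 2 * ln 2 + ln (real n)" using n ln_realpow[of "2 :: real" 2] by (subst ln_mult) auto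
    \<comment> \<open>\<open>n \<ge> 2\<close> gives \<open>ln 2 \<le> ln n\<close>, which absorbs
      the additive constant.\<close>
    also have "\<dots> \<le> 3 * ln (real n)" using n ln_mono[of 2 "real n"] by simp
    finally show "real K \<le> 3 * ln (real n) / ln 2" by (simp add: field_simps)
    show "real M \<le> 4 * real n"
      using rK by (simp add: M_def)
  qed (use n in auto)
  also have "\<dots> = 600 / ln 2 * real n * ln (real n)" by simp
  finally show "\<exists>t s. big_step solver (input_state d \<gamma>) t s \<and>
      real t \<le> 600 / ln 2 * real n * ln (real n) \<and>
      {c. is_arg_min (objective d \<gamma>) (feasible n) c} = {output_vec n s}"
    using t(1) min by blast
qed simp

end
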